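(* Under the standing assumptions, the barycenter functional $\mathscr{B}$ is coercive on $\mathbb{P}_{\textup{cost}}(\mathcal{Y})$, in the sense that for every $\beta\in\mathbb{R}$ the sublevel set $L_\beta=\{\nu\in\mathbb{P}_{\textup{cost}}(\mathcal{Y}):\mathscr{B}(\nu)\le\beta\}$ satisfies $\sup_{\nu\in L_\beta}\int_{\mathcal{Y}}c(x_0,y)\,\mathrm{d}\nu(y)<\infty$ (so $L_\beta$ is tight and weakly precompact in $\mathcal{P}(\mathcal{Y})$, with all weak limit points in $\mathbb{P}_{\textup{cost}}(\mathcal{Y})$). Moreover $\mathscr{B}$ is lower semicontinuous with respect to weak convergence (in duality with bounded continuous functions) along sequences in $L_\beta$. Consequently there exists a signed barycenter $\bar\nu\in\mathbb{P}_{\textup{cost}}(\mathcal{Y})$, i.e. $\mathscr{B}(\bar\nu)=\min_{\nu\in\mathbb{P}_{\textup{cost}}(\mathcal{Y})}\mathscr{B}(\nu)$.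
   Context: Standing assumptions. $\mathcal{X},\mathcal{Y}\subset\mathbb{R}^d$ are open sets and $c:\mathcal{X}\times\mathcal{Y}\to[0,\infty)$ satisfies: (A1) $c\in C^2(\mathcal{X}\times\mathcal{Y})$ and $c$ is bi-twisted, i.e. $y\mapsto\nabla_x c(x,y)$ and $x\mapsto\nabla_y c(x,y)$ are injective; (A2) for every $b\in\mathbb{R}$ and $(x',y')\in\mathcal{X}\times\mathcal{Y}$ the sets $\{x\in\mathcal{X}:c(x,y')\le b\}$ and $\{y\in\mathcal{Y}:c(x',y)\le b\}$ are compact; (A3) there is a point $(x_0,y_0)\in\mathcal{X}\times\mathcal{Y}$ such that for every $\varepsilon>0$ there is $B_\varepsilon>0$ with $(1-\varepsilon)c(x_0,y)-B_\varepsilon c(x,y_0)\le c(x,y)\le(1+\varepsilon)c(x_0,y)+B_\varepsilon c(x,y_0)$ and $(1-\varepsilon)c(x,y_0)-B_\varepsilon c(x_0,y)\le c(x,y)\le(1+\varepsilon)c(x,y_0)+B_\varepsilon c(x_0,y)$ for all $(x,y)\in\mathcal{X}\times\mathcal{Y}$. Define $\mathbb{P}_{\textup{cost}}(\mathcal{X})=\{\mu\in\mathcal{P}(\mathcal{X}):\int c(x,y_0)\,\mathrm{d}\mu(x)<\infty\}$ and $\mathbb{P}_{\textup{cost}}(\mathcal{Y})=\{\nu\in\mathcal{P}(\mathcal{Y}):\int c(x_0,y)\,\mathrm{d}\nu(y)<\infty\}$; a superscript AC denotes the subset of measures absolutely continuous w.r.t. Lebesgue measure. $\Pi(\mu,\nu)$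 is the set of couplings and $K_c(\mu,\nu)=\inf_{\pi\in\Pi(\mu,\nu)}\int c\,\mathrm{d}\pi$. Fix nonzero real weights $a_1,\dots,a_m$ with $\sum_i a_i=1$ (some may be negative), let $I_+=\{i:a_i>0\}$, $I_-=\{i:a_i<0\}$, and fix $\mu_1,\dots,\mu_m\in\mathbb{P}_{\textup{cost}}(\mathcal{X})$. The barycenter functional is $\mathscr{B}(\nu)=\sum_{i=1}^m a_iK_c(\mu_i,\nu)$ for $\nu\in\mathbb{P}_{\textup{cost}}(\mathcal{Y})$; a signed barycenter is a minimizer of $\mathscr{B}$ over $\mathbb{P}_{\textup{cost}}(\mathcal{Y})$. *)

theory Defs
  imports "HOL-Analysis.Analysis" "HOL-Probability.Probability"
begin

definition C2_on :: "'b::euclidean_space set \<Rightarrow> ('b \<Rightarrow> real) \<Rightarrow> bool" where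
  "C2_on S f \<longleftrightarrow>
     (\<exists>(Df :: 'b \<Rightarrow> 'b \<Rightarrow>\<^sub>L real) (D2f :: 'b \<Rightarrow> 'b \<Rightarrow>\<^sub>L ('b \<Rightarrow>\<^sub>L real)).
        (\<forall>z\<in>S. (f has_derivative blinfun_apply (Df z)) (at z)) \<and>
        (\<forall>z\<in>S. (Df has_derivative blinfun_apply (D2f z)) (at z)) \<and>
        continuous_on S D2f)"

definition grad_x :: "('a::euclidean_space \<Rightarrow> 'a \<Rightarrow> real) \<Rightarrow> 'a \<Rightarrow> 'a \<Rightarrow> ('a \<Rightarrow> real)" where
  "grad_x c x y = frechet_derivative (\<lambda>x'. c x' y) (at x)"

definition grad_y :: "('a::euclidean_space \<Rightarrow> 'a \<Rightarrow> real) \<Rightarrow> 'a \<Rightarrow> 'a \<Rightarrow> ('a \<Rightarrow> real)" where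
  "grad_y c x y = frechet_derivative (\<lambda>y'. c x y') (at y)"

definition bi_twisted :: "'a::euclidean_space set \<Rightarrow> 'a set \<Rightarrow> ('a \<Rightarrow> 'a \<Rightarrow> real) \<Rightarrow> bool" where
  "bi_twisted X Y c \<longleftrightarrow>
     (\<forall>x\<in>X. inj_on (\<lambda>y. grad_x c x y) Y) \<and> (\<forall>y\<in>Y. inj_on (\<lambda>x. grad_y c x y) X)"

definition standing_assumptions ::
  "'a::euclidean_space set \<Rightarrow> 'a set \<Rightarrow> ('a \<Rightarrow> 'a \<Rightarrow> real) \<Rightarrow> 'a \<Rightarrow> 'a \<Rightarrow> bool" where
  "standing_assumptions X Y c x0 y0 \<longleftrightarrow>
     open X \<and> open Y \<and>
     (\<forall>x\<in>X. \<forall>y\<in>Y. 0 \<le> c x y) \<and>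
     \<comment> \<open>(A1)\<close>
     C2_on (X \<times> Y) (\<lambda>z. c (fst z) (snd z)) \<and> bi_twisted X Y c \<and>
     \<comment> \<open>(A2)\<close>
     (\<forall>b::real. \<forall>x'\<in>X. \<forall>y'\<in>Y.
        compact {x\<in>X. c x y' \<le> b} \<and> compact {y\<in>Y. c x' y \<le> b}) \<and>
     \<comment> \<open>(A3)\<close>
     x0 \<in> X \<and> y0 \<in> Y \<and>
     (\<forall>\<epsilon>>0. \<exists>B>0. \<forall>x\<in>X. \<forall>y\<in>Y.
        (1 - \<epsilon>) * c x0 y - B * c x y0 \<le> c x y \<and>
        c x y \<le> (1 + \<epsilon>) * c x0 y + B * c x y0 \<and>
        (1 - \<epsilon>) * c x y0 - B * c x0 y \<le> c x y \<and>
        c x y \<le> (1 + \<epsilon>) * c x y0 + B * c x0 y)"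

definition Prob :: "'b::topological_space set \<Rightarrow> 'b measure set" where
  "Prob S = {M. prob_space M \<and> space M = S \<and> sets M = sets (restrict_space borel S)}"

definition Pcost_X :: "'a::topological_space set \<Rightarrow> ('a \<Rightarrow> 'a \<Rightarrow> real) \<Rightarrow> 'a \<Rightarrow> 'a measure set" where
  "Pcost_X X c y0 = {\<mu> \<in> Prob X. (\<integral>\<^sup>+ x. ennreal (c x y0) \<partial>\<mu>) < \<infinity>}"

definition Pcost_Y :: "'a::topological_space set \<Rightarrow> ('a \<Rightarrow> 'a \<Rightarrow> real) \<Rightarrow> 'a \<Rightarrow> 'a measure set" where
  "Pcost_Y Y c x0 = {\<nu> \<in> Prob Y. (\<integral>\<^sup>+ y. ennreal (c x0 y) \<partial>\<nu>) < \<infinity>}"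

definition couplings :: "'a::topological_space set \<Rightarrow> 'a set \<Rightarrow> 'a measure \<Rightarrow> 'a measure \<Rightarrow> ('a \<times> 'a) measure set" where
  "couplings X Y \<mu> \<nu> = {\<pi> \<in> Prob (X \<times> Y).
      distr \<pi> (restrict_space borel X) fst = \<mu> \<and> distr \<pi> (restrict_space borel Y) snd = \<nu>}"

definition Kc :: "'a::topological_space set \<Rightarrow> 'a set \<Rightarrow> ('a \<Rightarrow> 'a \<Rightarrow> real) \<Rightarrow> 'a measure \<Rightarrow> 'a measure \<Rightarrow> ennreal" where
  "Kc X Y c \<mu> \<nu> = (INF \<pi> \<in> couplings X Y \<mu> \<nu>. \<integral>\<^sup>+ z. ennreal (c (fst z) (snd z)) \<partial>\<pi>)"

text \<open>Barycenter functional B(nu) = sum_i a_i K_c(mu_i, nu). On Pcost(Y) every K_c(mu_i,nu)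
  is finite (by (A3)), so the conversion to real is harmless there.\<close>
definition barycenter_fun :: "'a::topological_space set \<Rightarrow> 'a set \<Rightarrow> ('a \<Rightarrow> 'a \<Rightarrow> real) \<Rightarrow> nat \<Rightarrow>
    (nat \<Rightarrow> real) \<Rightarrow> (nat \<Rightarrow> 'a measure) \<Rightarrow> 'a measure \<Rightarrow> real" where
  "barycenter_fun X Y c m a \<mu> \<nu> = (\<Sum>i<m. a i * enn2real (Kc X Y c (\<mu> i) \<nu>))"

definition weak_conv :: "'b::topological_space set \<Rightarrow> (nat \<Rightarrow> 'b measure) \<Rightarrow> 'b measure \<Rightarrow> bool" where
  "weak_conv S \<nu>s \<nu> \<longleftrightarrow>
     (\<forall>f :: 'b \<Rightarrow> real. continuous_on S f \<longrightarrow> bounded (f ` S) \<longrightarrow>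
        (\<lambda>n. \<integral>y. f y \<partial>(\<nu>s n)) \<longlonglongrightarrow> (\<integral>y. f y \<partial>\<nu>))"

end

theory Submission
  imports Defs
begin

text \<open>Write \<open>J \<nu> = \<integral> c(x0, y) d\<nu>(y)\<close>. By (A3) the function \<open>h(x, y) = c(x, y) - c(x0, y)\<close> is
  bounded by \<open>\<epsilon> c(x0, y) + B c(x, y0)\<close> for every \<open>\<epsilon>\<close>, hence uniformly integrable over all couplings
  of a fixed \<open>\<mu>\<close> with measures \<open>\<nu>\<close> of bounded \<open>J\<close>. Therefore \<open>K(\<mu>, \<nu>) - J \<nu>\<close>, the infimum of
  \<open>\<integral> h d\<pi>\<close>, is weakly continuous on \<open>{J \<le> C}\<close>: an almost optimal coupling for \<open>\<nu>\<close> is rerouted to a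
  weakly close \<open>\<nu>'\<close> by a density on \<open>\<pi> \<otimes> \<nu>'\<close> that moves almost all mass only within the pieces of a
  fine partition of unity. Since the weights sum to 1, the functional is \<open>\<Sum> a\<^sub>i (K(\<mu>\<^sub>i, \<nu>) - J \<nu>) + J \<nu>\<close>,
  a weakly continuous part plus the lower semicontinuous \<open>J\<close>, and the same bound gives coercivity.

  Prokhorov's theorem is reduced to Helly's theorem on the line: a Borel coding of the unit cube by the
  Cantor set has a continuous decoding map, so weak limits (and Skorohod representations) of the coded
  measures can be pushed back.\<close>

section \<open>Coding the unit cube by a Cantor set\<close>

text \<open>The signs of the weights are the obstacle. Under weak convergence with bounded moments a
  small mass may run away and take a fixed amount of cost with it, so \<open>Kc\<close> is in
  general only lower semicontinuous, and a negative weight would reverse this. By (A3) the lost cost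
  equals the lost moment whatever \<open>\<mu> i\<close> is, so the losses add up with total
  coefficient 1, which is positive. In (A3) the large constant multiplies only c(x, y0), whose tail
  under the fixed measure is small by integrability, while large y enters with the small factor;
  what is left concerns compact sets, supplied by (A2). For the compactness part, only decoding has
  to be continuous. Binary digits read off the line itself jump at dyadic points, whereas the Cantor
  set leaves gaps across which its digits extend continuously. Tightness on the line comes for free
  because codes lie in [0, 1]; tightness in Y keeps the decoded limit from leaving Y.\<close>

primrec dyadic_remainder :: "real \<Rightarrow> nat \<Rightarrow> real" where
  "dyadic_remainder t 0 = t"
| "dyadic_remainder t (Suc k) =
     2 * dyadic_remainder t k - (if 1/2 \<le> dyadic_remainder t k then 1 else 0)"

definition binary_digit :: "real \<Rightarrow> nat \<Rightarrow> real" where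
  "binary_digit t k = (if 1/2 \<le> dyadic_remainder t k then 1 else 0)"

lemma binary_digit_cases: "binary_digit t k = 0 \<or> binary_digit t k = 1"
  by (simp add: binary_digit_def)

lemma dyadic_remainder_bounds:
  assumes "0 \<le> t" "t < 1"
  shows "0 \<le> dyadic_remainder t k \<and> dyadic_remainder t k < 1"
  using assms by (induction k) (auto simp: field_simps)

lemma binary_expansion:
  assumes "0 \<le> t" "t < 1"
  shows "(\<lambda>k. binary_digit t k / 2 ^ Suc k) sums t"
proof -
  have partial: "(\<Sum>k<n. binary_digit t k / 2 ^ Suc k) = t - dyadic_remainder t n / 2 ^ n" for n
    by (induction n) (auto simp: binary_digit_def field_simps)
  have "(\<lambda>n. dyadic_remainder t n / 2 ^ n) \<longlonglongrightarrow> 0"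
  proof (rule Lim_null_comparison)
    show "\<forall>\<^sub>F n in sequentially. norm (dyadic_remainder t n / 2 ^ n) \<le> (1/2) ^ n"
      using dyadic_remainder_bounds[OF assms]
      by (intro always_eventually allI) (simp add: power_divide divide_right_mono abs_le_iff less_imp_le)
    show "(\<lambda>n. (1/2) ^ n :: real) \<longlonglongrightarrow> 0"
      by (rule LIMSEQ_power_zero) simp
  qed
  then have "(\<lambda>n. t - dyadic_remainder t n / 2 ^ n) \<longlonglongrightarrow> t - 0"
    by (intro tendsto_diff tendsto_const)
  then show ?thesis
    unfolding sums_def partial by simp
qed

lemma measurable_binary_digit [measurable]: "(\<lambda>t. binary_digit t k) \<in> borel_measurable borel"
proof -
  have "(\<lambda>t. dyadic_remainder t k) \<in> borel_measurable borel"
    by (induction k) auto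
  then show ?thesis
    unfolding binary_digit_def by measurable
qed

section \<open>Ternary digits, extended continuously off the Cantor set\<close>

definition clamp01 :: "real \<Rightarrow> real" where
  "clamp01 v = max 0 (min 1 v)"

lemma clamp01_bounds: "0 \<le> clamp01 v" "clamp01 v \<le> 1"
  by (auto simp: clamp01_def)

text \<open>On the Cantor set this is the shift of the ternary expansion: the clamp is 0 on [0, 1/3]
  and 1 on [2/3, 1], so the leading digit is removed.\<close>

primrec triadic_remainder :: "real \<Rightarrow> nat \<Rightarrow> real" where
  "triadic_remainder u 0 = u"
| "triadic_remainder u (Suc k) =
     3 * triadic_remainder u k - 2 * clamp01 (3 * triadic_remainder u k - 1)"

text \<open>On the Cantor set this reads off half of the ternary digit; the clamp extends the digit
  continuously across the gaps to all of \<open>\<real>\<close>.\<close>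

definition cantor_digit :: "real \<Rightarrow> nat \<Rightarrow> real" where
  "cantor_digit u k = clamp01 (3 * triadic_remainder u k - 1)"

lemma cantor_digit_bounds: "0 \<le> cantor_digit u k" "cantor_digit u k \<le> 1"
  by (auto simp: cantor_digit_def clamp01_bounds)

lemma continuous_cantor_digit: "continuous_on UNIV (\<lambda>u. cantor_digit u k)"
proof -
  have "continuous_on UNIV (\<lambda>u. triadic_remainder u k)"
    by (induction k) (auto simp: clamp01_def intro!: continuous_intros)
  then show ?thesis
    unfolding cantor_digit_def clamp01_def by (intro continuous_intros)
qed

definition cantor_sum :: "(nat \<Rightarrow> real) \<Rightarrow> real" where
  "cantor_sum b = (\<Sum>i. 2 * b i / 3 ^ Suc i)"

lemma cantor_sum_facts:
  assumes b: "\<And>i. b i = 0 \<or> b i = 1"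
  shows "summable (\<lambda>i. 2 * b i / 3 ^ Suc i)"
    and "0 \<le> cantor_sum b" and "cantor_sum b \<le> 1"
    and "cantor_sum b = 2 * b 0 / 3 + cantor_sum (\<lambda>i. b (Suc i)) / 3"
proof -
  have geo: "(\<lambda>i. 2/3 * (1/3) ^ i :: real) sums 1"
    using sums_mult[OF geometric_sums[of "1/3::real"], of "2/3"] by simp
  have le: "2 * b i / 3 ^ Suc i \<le> 2/3 * (1/3) ^ i" and nn: "0 \<le> 2 * b i / 3 ^ Suc i" for i
    using b[of i] by (auto simp: power_divide)
  show sm: "summable (\<lambda>i. 2 * b i / 3 ^ Suc i)"
    by (rule summable_comparison_test'[OF sums_summable[OF geo], of 0]) (simp only: real_norm_def abs_of_nonneg[OF nn] le)
  show "0 \<le> cantor_sum b"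
    unfolding cantor_sum_def by (rule suminf_nonneg[OF sm nn])
  show "cantor_sum b \<le> 1"
    unfolding cantor_sum_def using suminf_le[OF le sm sums_summable[OF geo]] sums_unique[OF geo] by simp
  have "cantor_sum b = 2 * b 0 / 3 + (\<Sum>i. 2 * b (Suc i) / 3 ^ Suc (Suc i))"
    unfolding cantor_sum_def using suminf_split_head[OF sm] by simp
  also have "(\<Sum>i. 2 * b (Suc i) / 3 ^ Suc (Suc i)) = (\<Sum>i. (1/3) * (2 * b (Suc i) / 3 ^ Suc i))"
    by simp
  also have "\<dots> = (1/3) * cantor_sum (\<lambda>i. b (Suc i))"
    unfolding cantor_sum_def
  proof (rule suminf_mult)
    have "summable (\<lambda>i. 3 * (2 * b (Suc i) / 3 ^ Suc (Suc i)))"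
      by (intro summable_mult) (use sm in \<open>subst summable_Suc_iff\<close>)
    then show "summable (\<lambda>i. 2 * b (Suc i) / 3 ^ Suc i)" by simp
  qed
  finally show "cantor_sum b = 2 * b 0 / 3 + cantor_sum (\<lambda>i. b (Suc i)) / 3" by simp
qed

text \<open>Every tail of the expansion is again a Cantor sum, and self-similarity puts it into
  [0, 1/3] or [2/3, 1] according to its leading bit. On these two intervals the clamp is
  exact.\<close>

lemma cantor_digit_cantor_sum:
  assumes b: "\<And>i. b i = 0 \<or> b i = 1"
  shows "cantor_digit (cantor_sum b) k = b k"
proof -
  define S where "S j = cantor_sum (\<lambda>i. b (j + i))" for j
  have S: "0 \<le> S j" "S j \<le> 1" "S j = 2 * b j / 3 + S (Suc j) / 3" for j
    using cantor_sum_facts[of "\<lambda>i. b (j + i)"] b unfolding S_def by auto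
  have dig: "clamp01 (3 * S j - 1) = b j" for j
    using S(3)[of j] S(1,2)[of "Suc j"] b[of j] by (auto simp: clamp01_def)
  have "triadic_remainder (cantor_sum b) k = S k"
  proof (induction k)
    case 0
    then show ?case by (simp add: S_def)
  next
    case (Suc k)
    then show ?case using dig[of k] S(3)[of k] by simp
  qed
  then show ?thesis
    by (simp add: cantor_digit_def dig)
qed

text \<open>\<open>s\<close> interleaves the binary digits of all coordinates into one bit sequence
  and places it in the Cantor set; \<open>\<zeta>\<close> reads the bits back as uniformly
  convergent series of continuous functions. \<open>s\<close> itself can jump at dyadic coordinates
  and is only Borel.\<close>

lemma cantor_coding:
  obtains s :: "'a::euclidean_space \<Rightarrow> real" and \<zeta> :: "real \<Rightarrow> 'a"
  where "s \<in> borel_measurable borel" "range s \<subseteq> {0..1}" "continuous_on UNIV \<zeta>"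
    "\<And>y. (\<And>b. b \<in> Basis \<Longrightarrow> 0 \<le> y \<bullet> b \<and> y \<bullet> b < 1) \<Longrightarrow> \<zeta> (s y) = y"
proof -
  define e where "e i = from_nat_into (Basis :: 'a set) i" for i
  define idx where "idx b k = prod_encode (to_nat_on (Basis :: 'a set) b, k)" for b k
  \<comment> \<open>Positions whose first component is no basis index repeat some coordinate. They
    still hold a bit, and \<open>\<zeta>\<close> never reads them.\<close>
  define bits where "bits y j = binary_digit (y \<bullet> e (fst (prod_decode j))) (snd (prod_decode j))" for y j
  define s where "s y = cantor_sum (bits y)" for y
  define \<zeta> where "\<zeta> u = (\<Sum>b\<in>Basis. (\<Sum>k. cantor_digit u (idx b k) / 2 ^ Suc k) *\<^sub>R b)" for u
  have bits01: "bits y j = 0 \<or> bits y j = 1" for y j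
    unfolding bits_def by (rule binary_digit_cases)
  show thesis
  proof
    show "s \<in> borel_measurable borel"
      unfolding s_def cantor_sum_def bits_def by measurable
    show "range s \<subseteq> {0..1}"
      unfolding s_def using cantor_sum_facts(2,3)[OF bits01] by auto
    have half: "summable (\<lambda>k. 1 / 2 ^ Suc k :: real)"
      using summable_mult[OF summable_geometric[of "1/2::real"], of "1/2"] by (simp add: power_divide)
    have "continuous_on UNIV (\<lambda>u. \<Sum>k. cantor_digit u (idx b k) / 2 ^ Suc k)" for b
    proof (rule uniform_limit_theorem)
      show "uniform_limit UNIV (\<lambda>n u. \<Sum>k<n. cantor_digit u (idx b k) / 2 ^ Suc k)
              (\<lambda>u. \<Sum>k. cantor_digit u (idx b k) / 2 ^ Suc k) sequentially"
        by (rule Weierstrass_m_test[OF _ half]) (use cantor_digit_bounds in \<open>auto simp: divide_right_mono\<close>)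
      show "\<forall>\<^sub>F n in sequentially. continuous_on UNIV (\<lambda>u. \<Sum>k<n. cantor_digit u (idx b k) / 2 ^ Suc k)"
        by (intro always_eventually allI continuous_intros continuous_cantor_digit) auto
    qed simp
    then show "continuous_on UNIV \<zeta>"
      unfolding \<zeta>_def by (intro continuous_intros)
    fix y :: 'a
    assume y: "\<And>b. b \<in> Basis \<Longrightarrow> 0 \<le> y \<bullet> b \<and> y \<bullet> b < 1"
    have "(\<Sum>k. cantor_digit (s y) (idx b k) / 2 ^ Suc k) = y \<bullet> b" if b: "b \<in> Basis" for b
    proof -
      have "e (to_nat_on Basis b) = b"
        unfolding e_def by (rule from_nat_into_to_nat_on) (use b in \<open>auto simp: countable_finite\<close>)
      then have "cantor_digit (s y) (idx b k) = binary_digit (y \<bullet> b) k" for k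
        unfolding s_def cantor_digit_cantor_sum[OF bits01] by (simp add: bits_def idx_def)
      then show ?thesis
        using binary_expansion[of "y \<bullet> b"] y[OF b] by (simp add: sums_iff)
    qed
    then show "\<zeta> (s y) = y"
      unfolding \<zeta>_def by (simp add: euclidean_representation)
  qed
qed

section \<open>Sequential compactness of tight families on an open set\<close>

lemma ProbD:
  assumes "M \<in> Prob S"
  shows "prob_space M" "space M = S" "sets M = sets (restrict_space borel S)"
  using assms by (auto simp: Prob_def)

lemma continuous_on_measurable_Prob:
  assumes "M \<in> Prob S" "continuous_on S f"
  shows "f \<in> borel_measurable M"
  using borel_measurable_continuous_on_restrict[OF assms(2)]
  by (simp add: measurable_cong_sets[OF ProbD(3)[OF assms(1)] refl])

text \<open>Skorohod variables make the convergence pointwise, so it passes through the continuous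
  \<open>\<zeta>\<close>. Composed with \<open>\<tau>\<close>, a test function is continuous only on
  the open set \<open>D\<close>, the image of Y under \<open>\<sigma>\<close>; everything therefore
  depends on the limit variable decoding into \<open>D\<close> almost surely, which tightness
  provides.\<close>

lemma weak_limit_of_tight:
  fixes Y :: "'a::euclidean_space set" and \<nu> :: "nat \<Rightarrow> 'a measure"
  assumes Y: "open Y" and \<nu>: "\<And>n. \<nu> n \<in> Prob Y"
    and tight: "\<And>\<epsilon>::real. \<epsilon> > 0 \<Longrightarrow> \<exists>K. compact K \<and> K \<subseteq> Y \<and> (\<forall>n. measure (\<nu> n) (Y - K) \<le> \<epsilon>)"
  shows "\<exists>r \<nu>'. strict_mono r \<and> \<nu>' \<in> Prob Y \<and> Defs.weak_conv Y (\<nu> \<circ> r) \<nu>'"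
proof -
  obtain s :: "'a \<Rightarrow> real" and \<zeta>
    where s: "s \<in> borel_measurable borel" "range s \<subseteq> {0..1}" and \<zeta>: "continuous_on UNIV \<zeta>"
      and \<zeta>_s: "\<And>y. (\<And>b. b \<in> Basis \<Longrightarrow> 0 \<le> y \<bullet> b \<and> y \<bullet> b < 1) \<Longrightarrow> \<zeta> (s y) = y"
    using cantor_coding by blast
  \<comment> \<open>The ball inscribed in the unit cube: it is homeomorphic to the whole space and
    lies where \<open>\<zeta>\<close> inverts \<open>s\<close>.\<close>
  define U :: "'a set" where "U = ball ((1/2) *\<^sub>R One) (1/2)"
  have \<zeta>_s_U: "\<zeta> (s y) = y" if "y \<in> U" for y
  proof (rule \<zeta>_s)
    fix b :: 'a assume b: "b \<in> Basis"
    have "\<bar>((1/2) *\<^sub>R One - y) \<bullet> b\<bar> < 1/2"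
      using Basis_le_norm[OF b, of "(1/2) *\<^sub>R One - y"] that by (simp add: U_def dist_norm)
    then show "0 \<le> y \<bullet> b \<and> y \<bullet> b < 1"
      using b by (simp add: inner_diff_left abs_if split: if_splits)
  qed
  obtain \<sigma> \<tau> where hom: "homeomorphism (UNIV :: 'a set) U \<sigma> \<tau>"
    using homeomorphic_ball_UNIV[of "1/2" "(1/2) *\<^sub>R One :: 'a"] homeomorphic_sym
    unfolding homeomorphic_def U_def by fastforce
  have \<sigma>: "continuous_on UNIV \<sigma>" "\<And>y. \<sigma> y \<in> U" "\<And>y. \<tau> (\<sigma> y) = y"
    and \<tau>: "continuous_on U \<tau>"
    using hom unfolding homeomorphism_def by auto
  have code: "\<zeta> (s (\<sigma> y)) = \<sigma> y" for y
    using \<zeta>_s_U \<sigma>(2) by blast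
  have [measurable]: "(\<lambda>y. s (\<sigma> y)) \<in> borel_measurable borel" "\<zeta> \<in> borel_measurable borel"
    "\<sigma> \<in> borel_measurable borel"
    using s(1) borel_measurable_continuous_onI[OF \<sigma>(1)] borel_measurable_continuous_onI[OF \<zeta>] by measurable
  define D where "D = U \<inter> \<tau> -` Y"
  have openD: "open D"
    unfolding D_def by (rule continuous_open_preimage[OF \<tau> _ Y]) (simp add: U_def)
  have YD: "\<sigma> y \<in> D" if "y \<in> Y" for y
    using that \<sigma> by (simp add: D_def)
  have Dy: "\<tau> z \<in> Y" if "z \<in> D" for z
    using that by (simp add: D_def)
  interpret \<nu>: prob_space "\<nu> n" for n
    using ProbD(1)[OF \<nu>] .
  have space\<nu> [simp]: "space (\<nu> n) = Y" for n
    using ProbD(2)[OF \<nu>] .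
  have sets\<nu> [measurable_cong]: "sets (\<nu> n) = sets (restrict_space borel Y)" for n
    using ProbD(3)[OF \<nu>] .
  obtain y1 where y1: "y1 \<in> Y"
    using \<nu>.not_empty[of 0] by auto
  \<comment> \<open>The default \<open>y1\<close> serves reals that do not decode into Y. The coded
    laws do not charge them, and \<open>V_D\<close> shows the same of the limit.\<close>
  define H where "H u = (if \<zeta> u \<in> D then \<tau> (\<zeta> u) else y1)" for u
  have H_in: "H u \<in> Y" for u
    by (simp add: H_def Dy y1)
  have \<tau>_meas: "(\<lambda>z. if z \<in> D then \<tau> z else y1) \<in> borel_measurable borel"
    by (rule borel_measurable_continuous_on_if)
       (use openD \<tau> in \<open>auto simp: D_def intro: continuous_on_subset\<close>)
  have H_borel [measurable]: "H \<in> borel_measurable borel"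
    using measurable_compose[OF \<open>\<zeta> \<in> borel_measurable borel\<close> \<tau>_meas] by (simp add: H_def[abs_def])
  have H_meas [measurable]: "H \<in> borel \<rightarrow>\<^sub>M restrict_space borel Y"
    by (rule measurable_restrict_space2) (auto simp: H_in)
  have H_s: "H (s (\<sigma> y)) = y" if "y \<in> Y" for y
    using that by (simp add: H_def code YD \<sigma>(3))
  define \<mu> where "\<mu> n = distr (\<nu> n) borel (\<lambda>y. s (\<sigma> y))" for n
  have s\<nu> [measurable]: "(\<lambda>y. s (\<sigma> y)) \<in> borel_measurable (\<nu> n)" for n
    using measurable_restrict_space1[OF \<open>(\<lambda>y. s (\<sigma> y)) \<in> borel_measurable borel\<close>]
    by (simp add: measurable_cong_sets[OF sets\<nu> refl])
  have real_dist: "real_distribution (\<mu> n)" for n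
    unfolding \<mu>_def by (rule \<nu>.real_distribution_distr) simp
  have "Helly_Selection.tight \<mu>"
    unfolding Helly_Selection.tight_def
  proof (intro conjI allI impI)
    fix \<epsilon> :: real assume \<epsilon>: "0 < \<epsilon>"
    \<comment> \<open>Codes lie in [0, 1]; the left end -1 makes the half-open interval contain
      0.\<close>
    have "measure (\<mu> n) {-1<..1} = 1" for n
    proof -
      have "measure (\<mu> n) {-1<..1} = measure (\<nu> n) ((\<lambda>y. s (\<sigma> y)) -` {-1<..1} \<inter> space (\<nu> n))"
        unfolding \<mu>_def by (rule measure_distr) auto
      also have "(\<lambda>y. s (\<sigma> y)) -` {-1<..1} \<inter> space (\<nu> n) = space (\<nu> n)"
        using s(2) by (force simp: image_subset_iff)
      finally show ?thesis by (simp only: \<nu>.prob_space)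
    qed
    then show "\<exists>a b::real. a < b \<and> (\<forall>n. measure (\<mu> n) {a<..b} > 1 - \<epsilon>)"
      using \<epsilon> by (intro exI[of _ "-1"] exI[of _ 1]) auto
  qed (rule real_dist)
  from tight_imp_convergent_subsubsequence[OF this strict_mono_id]
  obtain r M where r: "strict_mono (r :: nat \<Rightarrow> nat)" and M: "real_distribution M"
    and conv: "weak_conv_m (\<mu> \<circ> r) M"
    by (auto simp: comp_def id_def)
  have "real_distribution ((\<mu> \<circ> r) n)" for n
    by (simp add: real_dist)
  from Skorohod[OF this M conv]
  obtain \<Omega> :: "real measure" and Vs V
    where \<Omega>: "prob_space \<Omega>" and Vs': "\<forall>n. Vs n \<in> borel_measurable \<Omega>"
      and dist': "\<forall>n. distr \<Omega> borel (Vs n) = (\<mu> \<circ> r) n"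
      and V': "V \<in> measurable \<Omega> lborel"
      and lim': "\<forall>\<omega> \<in> space \<Omega>. (\<lambda>n. Vs n \<omega>) \<longlonglongrightarrow> V \<omega>"
    by (elim exE conjE)
  have Vs [measurable]: "Vs n \<in> borel_measurable \<Omega>" for n
    using Vs' by blast
  note dist = dist'[rule_format] and lim = lim'[rule_format]
  have V [measurable]: "V \<in> borel_measurable \<Omega>"
    using V' by simp
  interpret \<Omega>: prob_space \<Omega> by fact
  have lim\<zeta>: "(\<lambda>n. \<zeta> (Vs n \<omega>)) \<longlonglongrightarrow> \<zeta> (V \<omega>)" if "\<omega> \<in> space \<Omega>" for \<omega>
    using continuous_on_tendsto_compose[OF \<zeta> lim[OF that]] by simp
  have law: "distr \<Omega> (restrict_space borel Y) (\<lambda>\<omega>. H (Vs n \<omega>)) = \<nu> (r n)" for n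
  proof -
    have "distr \<Omega> (restrict_space borel Y) (\<lambda>\<omega>. H (Vs n \<omega>))
        = distr (distr \<Omega> borel (Vs n)) (restrict_space borel Y) H"
      by (subst distr_distr) (auto simp: comp_def)
    also have "\<dots> = distr (\<nu> (r n)) (restrict_space borel Y) (\<lambda>y. H (s (\<sigma> y)))"
      unfolding dist comp_apply \<mu>_def by (subst distr_distr) (auto simp: comp_def)
    also have "\<dots> = distr (\<nu> (r n)) (\<nu> (r n)) (\<lambda>y. y)"
      by (rule distr_cong) (auto simp: sets\<nu> H_s)
    finally show ?thesis by simp
  qed
  \<comment> \<open>A reverse Fatou argument: with probability at least 1 - \<epsilon> infinitely
    many \<open>\<zeta> (Vs n \<omega>)\<close> lie in the image of K, which is closed and hence
    contains the limit as well.\<close>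
  have V_D: "AE \<omega> in \<Omega>. \<zeta> (V \<omega>) \<in> D"
  proof -
    have [measurable]: "D \<in> sets borel" using openD by simp
    define E where "E = {\<omega> \<in> space \<Omega>. \<zeta> (V \<omega>) \<in> D}"
    have E: "E \<in> sets \<Omega>" unfolding E_def by measurable
    have ge: "1 - \<epsilon> \<le> measure \<Omega> E" if \<epsilon>: "\<epsilon> > 0" for \<epsilon> :: real
    proof -
      obtain K where K: "compact K" "K \<subseteq> Y" "\<And>n. measure (\<nu> n) (Y - K) \<le> \<epsilon>"
        using tight[OF \<epsilon>] by blast
      have cl: "closed (\<sigma> ` K)"
        by (intro compact_imp_closed compact_continuous_image continuous_on_subset[OF \<sigma>(1)] K) auto
      have [measurable]: "\<sigma> ` K \<in> sets borel" using cl by simp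
      define A where "A n = {\<omega> \<in> space \<Omega>. \<zeta> (Vs n \<omega>) \<in> \<sigma> ` K}" for n
      have A [measurable]: "A n \<in> sets \<Omega>" for n unfolding A_def by measurable
      have A_ge: "1 - \<epsilon> \<le> measure \<Omega> (A n)" for n
      proof -
        have "measure \<Omega> (A n) = measure (distr \<Omega> borel (Vs n)) (\<zeta> -` (\<sigma> ` K))"
          by (subst measure_distr) (auto simp: A_def intro!: arg_cong[where f="measure \<Omega>"] measurable_sets_borel[OF \<open>\<zeta> \<in> borel_measurable borel\<close>])
        also have "\<dots> = measure (\<nu> (r n)) ((\<lambda>y. s (\<sigma> y)) -` (\<zeta> -` (\<sigma> ` K)) \<inter> space (\<nu> (r n)))"
          unfolding dist comp_apply \<mu>_def
          by (rule measure_distr) (auto intro!: measurable_sets_borel[OF \<open>\<zeta> \<in> borel_measurable borel\<close>])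
        also have "(\<lambda>y. s (\<sigma> y)) -` (\<zeta> -` (\<sigma> ` K)) \<inter> space (\<nu> (r n)) = K"
          using K(2) \<sigma>(3) by (auto simp: code) (metis image_iff)
        also have "measure (\<nu> (r n)) K = 1 - measure (\<nu> (r n)) (Y - K)"
        proof -
          have "K \<in> sets (\<nu> (r n))"
            unfolding sets\<nu> using K compact_imp_closed[OF K(1)] Y
            by (subst sets_restrict_space_iff) auto
          then show ?thesis
            using \<nu>.prob_compl[of K "r n"] by simp
        qed
        also have "\<dots> \<ge> 1 - \<epsilon>" using K(3)[of "r n"] by simp
        finally show ?thesis .
      qed
      define Bs where "Bs m = (\<Union>n\<in>{m..}. A n)" for m
      have Bs: "range Bs \<subseteq> sets \<Omega>" "decseq Bs"
        by (auto simp: Bs_def decseq_def) (use order_trans in blast)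
      have "1 - \<epsilon> \<le> measure \<Omega> (Bs m)" for m
        using A_ge[of m] \<Omega>.finite_measure_mono[of "A m" "Bs m"] Bs by (force simp: Bs_def)
      then have "1 - \<epsilon> \<le> measure \<Omega> (\<Inter>m. Bs m)"
        by (intro LIMSEQ_le_const[OF \<Omega>.finite_Lim_measure_decseq[OF Bs]]) auto
      also have "\<dots> \<le> measure \<Omega> E"
      proof (rule \<Omega>.finite_measure_mono[OF _ E], rule subsetI)
        fix \<omega> assume \<omega>: "\<omega> \<in> (\<Inter>m. Bs m)"
        then have sp: "\<omega> \<in> space \<Omega>" by (auto simp: Bs_def A_def)
        have freq: "\<exists>\<^sub>F n in sequentially. \<zeta> (Vs n \<omega>) \<in> \<sigma> ` K"
          unfolding frequently_sequentially using \<omega> by (auto simp: Bs_def A_def Bex_def)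
        have "\<zeta> (V \<omega>) \<in> \<sigma> ` K"
        proof (rule ccontr)
          assume "\<zeta> (V \<omega>) \<notin> \<sigma> ` K"
          then have "\<forall>\<^sub>F n in sequentially. \<zeta> (Vs n \<omega>) \<in> - (\<sigma> ` K)"
            using topological_tendstoD[OF lim\<zeta>[OF sp], of "- (\<sigma> ` K)"] cl by auto
          then show False using freq by (simp add: frequently_def)
        qed
        then show "\<omega> \<in> E" using sp K(2) YD by (auto simp: E_def)
      qed
      finally show ?thesis .
    qed
    have "1 \<le> measure \<Omega> E"
    proof (rule field_le_epsilon)
      fix e :: real assume "0 < e"
      then show "1 \<le> measure \<Omega> E + e" using ge[of e] by linarith
    qed
    then have "measure \<Omega> E = 1" using \<Omega>.prob_le_1[of E] by simp
    then have "AE \<omega> in \<Omega>. \<omega> \<in> E" using \<Omega>.prob_eq_1[OF E] by blast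
    then show ?thesis by (rule eventually_mono) (simp add: E_def)
  qed
  define \<nu>' where "\<nu>' = distr \<Omega> (restrict_space borel Y) (\<lambda>\<omega>. H (V \<omega>))"
  have "\<nu>' \<in> Prob Y"
    unfolding \<nu>'_def Prob_def by (auto intro!: \<Omega>.prob_space_distr simp: space_restrict_space)
  moreover have "Defs.weak_conv Y (\<nu> \<circ> r) \<nu>'"
    unfolding Defs.weak_conv_def
  proof (intro allI impI)
    fix f :: "'a \<Rightarrow> real"
    assume f: "continuous_on Y f" and "bounded (f ` Y)"
    then obtain B where B: "\<And>y. y \<in> Y \<Longrightarrow> norm (f y) \<le> B"
      by (auto simp: bounded_iff)
    have fm [measurable]: "f \<in> borel_measurable (restrict_space borel Y)"
      by (rule borel_measurable_continuous_on_restrict[OF f])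
    have "(\<lambda>n. \<integral>\<omega>. f (H (Vs n \<omega>)) \<partial>\<Omega>) \<longlonglongrightarrow> (\<integral>\<omega>. f (H (V \<omega>)) \<partial>\<Omega>)"
    proof (rule integral_dominated_convergence[where w="\<lambda>_. B"])
      show "AE \<omega> in \<Omega>. (\<lambda>n. f (H (Vs n \<omega>))) \<longlonglongrightarrow> f (H (V \<omega>))"
        using V_D AE_space
      proof eventually_elim
        case (elim \<omega>)
        have "continuous_on D (\<lambda>z. f (\<tau> z))"
          by (rule continuous_on_compose2[OF f]) (use \<tau> Dy in \<open>auto simp: D_def intro: continuous_on_subset\<close>)
        then have "isCont (\<lambda>z. f (\<tau> z)) (\<zeta> (V \<omega>))"
          using openD elim by (simp add: continuous_on_eq_continuous_at)
        from isCont_tendsto_compose[OF this lim\<zeta>[OF elim(2)]]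
        have "(\<lambda>n. f (\<tau> (\<zeta> (Vs n \<omega>)))) \<longlonglongrightarrow> f (H (V \<omega>))"
          using elim by (simp add: H_def)
        moreover have "\<forall>\<^sub>F n in sequentially. \<zeta> (Vs n \<omega>) \<in> D"
          using topological_tendstoD[OF lim\<zeta>[OF elim(2)] openD] elim by simp
        then have "\<forall>\<^sub>F n in sequentially. f (\<tau> (\<zeta> (Vs n \<omega>))) = f (H (Vs n \<omega>))"
          by eventually_elim (simp add: H_def)
        ultimately show ?case
          by (rule Lim_transform_eventually)
      qed
    qed (use B H_in in auto)
    moreover have "(\<integral>y. f y \<partial>(\<nu> \<circ> r) n) = (\<integral>\<omega>. f (H (Vs n \<omega>)) \<partial>\<Omega>)" for n
      unfolding comp_apply law[symmetric] by (subst integral_distr) auto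
    moreover have "(\<integral>y. f y \<partial>\<nu>') = (\<integral>\<omega>. f (H (V \<omega>)) \<partial>\<Omega>)"
      unfolding \<nu>'_def by (subst integral_distr) auto
    ultimately show "(\<lambda>n. \<integral>y. f y \<partial>(\<nu> \<circ> r) n) \<longlonglongrightarrow> (\<integral>y. f y \<partial>\<nu>')"
      by simp
  qed
  ultimately show ?thesis using r by blast
qed

section \<open>Rerouting a coupling to a nearby second marginal\<close>

text \<open>Couplings are declared on the Borel sets of a product, pair measures on the product
  sigma-algebra. Second countability identifies the two, and each inclusion is measurability of the
  identity.\<close>

lemma sets_restrict_borel_Times:
  fixes A :: "'a::second_countable_topology set" and B :: "'b::second_countable_topology set"
  shows "sets (restrict_space borel (A \<times> B)) = sets (restrict_space borel A \<Otimes>\<^sub>M restrict_space borel B)"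
proof -
  let ?L = "restrict_space borel (A \<times> B) :: ('a \<times> 'b) measure"
  let ?R = "restrict_space borel A \<Otimes>\<^sub>M restrict_space borel B :: ('a \<times> 'b) measure"
  have space: "space ?L = space ?R"
    by (simp add: space_restrict_space space_pair_measure)
  have *: "sets N \<subseteq> sets M" if "(\<lambda>z. z) \<in> M \<rightarrow>\<^sub>M N" "space M = space N" for M N :: "('a \<times> 'b) measure"
  proof
    fix S assume S: "S \<in> sets N"
    from measurable_sets[OF that(1) S] sets.sets_into_space[OF S] that(2) show "S \<in> sets M"
      by (simp add: Int_absorb2)
  qed
  have "(\<lambda>z. (fst z, snd z)) \<in> ?L \<rightarrow>\<^sub>M ?R"
    by (intro measurable_Pair measurable_restrict_space2 measurable_restrict_space1)
       (auto simp: space_restrict_space borel_prod[symmetric])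
  then have 1: "sets ?R \<subseteq> sets ?L" using space by (intro *) simp_all
  have "(\<lambda>z. (fst z, snd z)) \<in> ?R \<rightarrow>\<^sub>M (borel \<Otimes>\<^sub>M borel)"
    by (intro measurable_Pair measurable_compose[OF measurable_fst] measurable_compose[OF measurable_snd]
        measurable_restrict_space1) auto
  then have "(\<lambda>z. (fst z, snd z)) \<in> ?R \<rightarrow>\<^sub>M ?L"
    unfolding borel_prod by (intro measurable_restrict_space2) (auto simp: space_pair_measure space_restrict_space)
  then have 2: "sets ?L \<subseteq> sets ?R" using space by (intro *) simp_all
  show ?thesis using 1 2 by blast
qed

lemma measurable_fst_restrict_Times:
  "fst \<in> restrict_space borel (A \<times> B) \<rightarrow>\<^sub>M restrict_space borel (A :: 'a::second_countable_topology set)"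
  and measurable_snd_restrict_Times:
  "snd \<in> restrict_space borel (A \<times> B) \<rightarrow>\<^sub>M restrict_space borel (B :: 'b::second_countable_topology set)"
  by (simp_all add: measurable_cong_sets[OF sets_restrict_borel_Times refl])

lemma couplingsD:
  assumes "\<pi> \<in> couplings X Y \<mu> (\<nu> :: 'a::euclidean_space measure)"
  shows "\<pi> \<in> Prob (X \<times> Y)" "sets \<mu> = sets (restrict_space borel X)" "sets \<nu> = sets (restrict_space borel Y)"
    and "fst \<in> \<pi> \<rightarrow>\<^sub>M \<mu>" "snd \<in> \<pi> \<rightarrow>\<^sub>M \<nu>" "distr \<pi> \<mu> fst = \<mu>" "distr \<pi> \<nu> snd = \<nu>"
proof -
  show \<pi>: "\<pi> \<in> Prob (X \<times> Y)" and s1: "sets \<mu> = sets (restrict_space borel X)"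
    and s2: "sets \<nu> = sets (restrict_space borel Y)"
    using assms by (auto simp: couplings_def)
  show "fst \<in> \<pi> \<rightarrow>\<^sub>M \<mu>" "snd \<in> \<pi> \<rightarrow>\<^sub>M \<nu>"
    using measurable_fst_restrict_Times measurable_snd_restrict_Times
    by (auto simp: measurable_cong_sets[OF ProbD(3)[OF \<pi>] s1] measurable_cong_sets[OF ProbD(3)[OF \<pi>] s2])
  show "distr \<pi> \<mu> fst = \<mu>" "distr \<pi> \<nu> snd = \<nu>"
    using assms distr_cong[OF refl s1, of \<pi> fst fst] distr_cong[OF refl s2, of \<pi> snd snd]
    by (auto simp: couplings_def)
qed

lemma nn_integral_coupling:
  assumes "\<pi> \<in> couplings X Y \<mu> (\<nu> :: 'a::euclidean_space measure)"
  shows "f \<in> borel_measurable \<mu> \<Longrightarrow> (\<integral>\<^sup>+z. f (fst z) \<partial>\<pi>) = (\<integral>\<^sup>+x. f x \<partial>\<mu>)"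
    and "g \<in> borel_measurable \<nu> \<Longrightarrow> (\<integral>\<^sup>+z. g (snd z) \<partial>\<pi>) = (\<integral>\<^sup>+y. g y \<partial>\<nu>)"
  using nn_integral_distr[OF couplingsD(4)[OF assms], of f] nn_integral_distr[OF couplingsD(5)[OF assms], of g]
  by (simp_all add: couplingsD(6,7)[OF assms])

text \<open>Gluing without disintegration: \<open>w\<close> is the density of a coupling of \<nu>
  and \<nu>' with respect to their product, so weighting
  \<open>\<pi> \<Otimes>\<^sub>M \<nu>'\<close> by it gives a joint law of (x, y, y') in which (x,
  y) still has law \<pi>. Forgetting y leaves the new coupling. The three integral identities
  describe the laws of (x, y), y' and (x, y').\<close>

lemma reroute_coupling:
  fixes X Y :: "'a::euclidean_space set" and w :: "'a \<Rightarrow> 'a \<Rightarrow> ennreal"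
  assumes \<pi>: "\<pi> \<in> couplings X Y \<mu> \<nu>" and \<nu>': "\<nu>' \<in> Prob Y"
    and w: "(\<lambda>(y, y'). w y y') \<in> borel_measurable (\<nu> \<Otimes>\<^sub>M \<nu>')"
    and w1: "AE y in \<nu>. (\<integral>\<^sup>+y'. w y y' \<partial>\<nu>') = 1"
    and w2: "AE y' in \<nu>'. (\<integral>\<^sup>+y. w y y' \<partial>\<nu>) = 1"
  obtains \<pi>' where "\<pi>' \<in> couplings X Y \<mu> \<nu>'"
    and "\<And>f. f \<in> borel_measurable \<pi> \<Longrightarrow> (\<integral>\<^sup>+p. w (snd (fst p)) (snd p) * f (fst p) \<partial>(\<pi> \<Otimes>\<^sub>M \<nu>')) = (\<integral>\<^sup>+z. f z \<partial>\<pi>)"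
    and "\<And>f. f \<in> borel_measurable \<nu>' \<Longrightarrow> (\<integral>\<^sup>+p. w (snd (fst p)) (snd p) * f (snd p) \<partial>(\<pi> \<Otimes>\<^sub>M \<nu>')) = (\<integral>\<^sup>+y'. f y' \<partial>\<nu>')"
    and "\<And>f. f \<in> borel_measurable (restrict_space borel (X \<times> Y)) \<Longrightarrow>
           (\<integral>\<^sup>+p. w (snd (fst p)) (snd p) * f (fst (fst p), snd p) \<partial>(\<pi> \<Otimes>\<^sub>M \<nu>')) = (\<integral>\<^sup>+z. f z \<partial>\<pi>')"
proof -
  note \<pi>P = couplingsD(1)[OF \<pi>]
  interpret \<pi>: prob_space \<pi> using ProbD(1)[OF \<pi>P] .
  interpret \<nu>': prob_space \<nu>' using ProbD(1)[OF \<nu>'] .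
  interpret pair_sigma_finite \<pi> \<nu>' ..
  have s\<nu>': "sets \<nu>' = sets (restrict_space borel Y)" by (rule ProbD(3)[OF \<nu>'])
  have [measurable]: "fst \<in> \<pi> \<rightarrow>\<^sub>M \<mu>" "snd \<in> \<pi> \<rightarrow>\<^sub>M \<nu>" using couplingsD[OF \<pi>] by auto
  note w' [measurable] = w[unfolded case_prod_unfold]
  have wm [measurable]: "(\<lambda>p. w (snd (fst p)) (snd p)) \<in> borel_measurable (\<pi> \<Otimes>\<^sub>M \<nu>')"
    using measurable_compose[of "\<lambda>p. (snd (fst p), snd p)" "\<pi> \<Otimes>\<^sub>M \<nu>'" "\<nu> \<Otimes>\<^sub>M \<nu>'", OF _ w'] by simp
  define \<Gamma> where "\<Gamma> = density (\<pi> \<Otimes>\<^sub>M \<nu>') (\<lambda>p. w (snd (fst p)) (snd p))"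
  define \<pi>' where "\<pi>' = distr \<Gamma> (restrict_space borel (X \<times> Y)) (\<lambda>p. (fst (fst p), snd p))"
  have map [measurable]: "(\<lambda>p. (fst (fst p), snd p)) \<in> (\<pi> \<Otimes>\<^sub>M \<nu>') \<rightarrow>\<^sub>M restrict_space borel (X \<times> Y)"
    using couplingsD(2)[OF \<pi>]
    by (simp add: measurable_cong_sets[OF refl sets_restrict_borel_Times]
        measurable_cong_sets[OF refl sets_pair_measure_cong[OF couplingsD(2)[OF \<pi>, symmetric] s\<nu>'[symmetric]]])
  have R1: "(\<integral>\<^sup>+p. w (snd (fst p)) (snd p) * f (fst p) \<partial>(\<pi> \<Otimes>\<^sub>M \<nu>')) = (\<integral>\<^sup>+z. f z \<partial>\<pi>)"
    if [measurable]: "f \<in> borel_measurable \<pi>" for f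
  proof -
    have "AE z in \<pi>. (\<integral>\<^sup>+y'. w (snd z) y' \<partial>\<nu>') = 1"
      by (rule AE_distrD[OF \<open>snd \<in> \<pi> \<rightarrow>\<^sub>M \<nu>\<close>]) (unfold couplingsD(7)[OF \<pi>], rule w1)
    then have "AE z in \<pi>. (\<integral>\<^sup>+y'. w (snd z) y' * f z \<partial>\<nu>') = f z"
      using AE_space
    proof eventually_elim
      case (elim z)
      have "(\<lambda>y'. w (snd z) y') \<in> borel_measurable \<nu>'"
        using measurable_compose[OF measurable_Pair1'[OF elim(2), of \<nu>'] wm] by simp
      then show ?case using elim by (simp add: nn_integral_multc)
    qed
    then have "(\<integral>\<^sup>+z. \<integral>\<^sup>+y'. w (snd z) y' * f z \<partial>\<nu>' \<partial>\<pi>) = (\<integral>\<^sup>+z. f z \<partial>\<pi>)"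
      by (rule nn_integral_cong_AE)
    then show ?thesis by (subst \<nu>'.nn_integral_fst[symmetric]) simp_all
  qed
  have R2: "(\<integral>\<^sup>+p. w (snd (fst p)) (snd p) * f (snd p) \<partial>(\<pi> \<Otimes>\<^sub>M \<nu>')) = (\<integral>\<^sup>+y'. f y' \<partial>\<nu>')"
    if [measurable]: "f \<in> borel_measurable \<nu>'" for f
  proof -
    have "(\<integral>\<^sup>+p. w (snd (fst p)) (snd p) * f (snd p) \<partial>(\<pi> \<Otimes>\<^sub>M \<nu>'))
        = (\<integral>\<^sup>+y'. \<integral>\<^sup>+z. w (snd z) y' * f y' \<partial>\<pi> \<partial>\<nu>')"
      by (subst nn_integral_snd[symmetric]) simp_all
    also have "\<dots> = (\<integral>\<^sup>+y'. f y' \<partial>\<nu>')"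
    proof (rule nn_integral_cong_AE)
      show "AE y' in \<nu>'. (\<integral>\<^sup>+z. w (snd z) y' * f y' \<partial>\<pi>) = f y'"
        using w2 AE_space
      proof eventually_elim
        case (elim y')
        have m: "(\<lambda>y. w y y') \<in> borel_measurable \<nu>"
          using measurable_compose[OF measurable_Pair2'[OF elim(2), of \<nu>] w'] by simp
        then have "(\<lambda>z. w (snd z) y') \<in> borel_measurable \<pi>" by measurable
        then show ?case using elim nn_integral_coupling(2)[OF \<pi> m] by (simp add: nn_integral_multc)
      qed
    qed
    finally show ?thesis .
  qed
  have R3: "(\<integral>\<^sup>+p. w (snd (fst p)) (snd p) * f (fst (fst p), snd p) \<partial>(\<pi> \<Otimes>\<^sub>M \<nu>')) = (\<integral>\<^sup>+z. f z \<partial>\<pi>')"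
    if [measurable]: "f \<in> borel_measurable (restrict_space borel (X \<times> Y))" for f
  proof -
    have "(\<integral>\<^sup>+z. f z \<partial>\<pi>') = (\<integral>\<^sup>+p. f (fst (fst p), snd p) \<partial>\<Gamma>)"
      unfolding \<pi>'_def by (rule nn_integral_distr) (simp_all add: \<Gamma>_def)
    also have "\<dots> = (\<integral>\<^sup>+p. w (snd (fst p)) (snd p) * f (fst (fst p), snd p) \<partial>(\<pi> \<Otimes>\<^sub>M \<nu>'))"
      unfolding \<Gamma>_def by (rule nn_integral_density) measurable
    finally show ?thesis by simp
  qed
  have space\<pi>': "space \<pi>' = X \<times> Y" and sets\<pi>': "sets \<pi>' = sets (restrict_space borel (X \<times> Y))"
    by (auto simp: \<pi>'_def space_restrict_space)
  have "emeasure \<pi>' (space \<pi>') = (\<integral>\<^sup>+z. 1 \<partial>\<pi>')" by simp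
  also have "\<dots> = 1" using R3[of "\<lambda>_. 1"] R1[of "\<lambda>_. 1"] by (simp add: \<pi>.emeasure_space_1)
  finally have "\<pi>' \<in> Prob (X \<times> Y)"
    by (auto simp: Prob_def space\<pi>' sets\<pi>' intro!: prob_spaceI)
  note f\<pi>' = measurable_fst_restrict_Times[of X Y, folded measurable_cong_sets[OF sets\<pi>' refl]]
    and s\<pi>' = measurable_snd_restrict_Times[of X Y, folded measurable_cong_sets[OF sets\<pi>' refl]]
  moreover have "distr \<pi>' (restrict_space borel X) fst = \<mu>"
  proof (rule measure_eqI)
    fix A assume "A \<in> sets (distr \<pi>' (restrict_space borel X) fst)"
    then have A: "A \<in> sets (restrict_space borel X)" by simp
    then have A\<mu> [measurable]: "A \<in> sets \<mu>" using couplingsD(2)[OF \<pi>] by simp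
    have "emeasure (distr \<pi>' (restrict_space borel X) fst) A = (\<integral>\<^sup>+x. indicator A x \<partial>distr \<pi>' (restrict_space borel X) fst)"
      using A by simp
    also have "\<dots> = (\<integral>\<^sup>+z. indicator A (fst z) \<partial>\<pi>')"
      by (rule nn_integral_distr[OF f\<pi>']) (use A in simp)
    also have "\<dots> = (\<integral>\<^sup>+p. w (snd (fst p)) (snd p) * indicator A (fst (fst p)) \<partial>(\<pi> \<Otimes>\<^sub>M \<nu>'))"
      by (subst R3[symmetric]) (use measurable_compose[OF measurable_fst_restrict_Times[of X Y] borel_measurable_indicator[OF A]] in simp_all)
    also have "\<dots> = (\<integral>\<^sup>+z. indicator A (fst z) \<partial>\<pi>)"
      by (rule R1) measurable
    also have "\<dots> = emeasure \<mu> A"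
      using nn_integral_coupling(1)[OF \<pi>, of "indicator A"] by simp
    finally show "emeasure (distr \<pi>' (restrict_space borel X) fst) A = emeasure \<mu> A" .
  qed (simp add: couplingsD(2)[OF \<pi>])
  moreover have "distr \<pi>' (restrict_space borel Y) snd = \<nu>'"
  proof (rule measure_eqI)
    fix A assume "A \<in> sets (distr \<pi>' (restrict_space borel Y) snd)"
    then have A: "A \<in> sets (restrict_space borel Y)" by simp
    then have A\<nu>' [measurable]: "A \<in> sets \<nu>'" using s\<nu>' by simp
    have "emeasure (distr \<pi>' (restrict_space borel Y) snd) A = (\<integral>\<^sup>+x. indicator A x \<partial>distr \<pi>' (restrict_space borel Y) snd)"
      using A by simp
    also have "\<dots> = (\<integral>\<^sup>+z. indicator A (snd z) \<partial>\<pi>')"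
      by (rule nn_integral_distr[OF s\<pi>']) (use A in simp)
    also have "\<dots> = (\<integral>\<^sup>+p. w (snd (fst p)) (snd p) * indicator A (snd p) \<partial>(\<pi> \<Otimes>\<^sub>M \<nu>'))"
      by (subst R3[symmetric]) (use measurable_compose[OF measurable_snd_restrict_Times[of X Y] borel_measurable_indicator[OF A]] in simp_all)
    also have "\<dots> = emeasure \<nu>' A"
      by (subst R2) simp_all
    finally show "emeasure (distr \<pi>' (restrict_space borel Y) snd) A = emeasure \<nu>' A" .
  qed (simp add: s\<nu>')
  ultimately have "\<pi>' \<in> couplings X Y \<mu> \<nu>'"
    using \<open>\<pi>' \<in> Prob (X \<times> Y)\<close> by (simp add: couplings_def)
  then show thesis using R1 R2 R3 that by blast
qed

text \<open>Integrating over y turns \<open>\<phi> k y\<close> into \<open>q k\<close> and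
  \<open>r' y\<close> into \<open>R\<close>; what remains is the sum of
  \<open>t k / p k * \<phi> k x\<close> plus \<open>r x\<close>, which is 1 by the choice of
  \<open>r\<close>. The auxiliary quantities are parameters so that exchanging the two measures
  yields the other marginal.\<close>

lemma transport_weight_marginal:
  fixes \<phi> :: "'k \<Rightarrow> 'b \<Rightarrow> real" and p q :: "'k \<Rightarrow> real"
  assumes M: "prob_space M" and N: "prob_space N" and sets: "sets N = sets M"
    and J: "finite J"
    and meas': "\<forall>k\<in>J. \<phi> k \<in> borel_measurable M"
    and nonneg': "\<forall>k\<in>J. \<forall>x\<in>space M. 0 \<le> \<phi> k x"
    and one': "\<forall>x\<in>space M. (\<Sum>k\<in>J. \<phi> k x) = 1"
    and p: "\<And>k. p k = (\<integral>x. \<phi> k x \<partial>M)" and q: "\<And>k. q k = (\<integral>x. \<phi> k x \<partial>N)"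
    and t: "\<And>k. t k = min (p k) (q k)"
    and r: "\<And>x. r x = 1 - (\<Sum>k\<in>J. t k / p k * \<phi> k x)"
    and r': "\<And>x. r' x = 1 - (\<Sum>k\<in>J. t k / q k * \<phi> k x)"
    and R: "R = 1 - (\<Sum>k\<in>J. t k)"
  shows "0 \<le> R" and "\<And>x. x \<in> space M \<Longrightarrow> 0 \<le> r x" and "\<And>x. x \<in> space M \<Longrightarrow> 0 \<le> r' x"
    and "integrable M r" and "integrable N r'" and "(\<integral>x. r x \<partial>M) = R" and "(\<integral>x. r' x \<partial>N) = R"
    and "\<And>k. k \<in> J \<Longrightarrow> integrable M (\<phi> k)" and "\<And>k. k \<in> J \<Longrightarrow> integrable N (\<phi> k)"
    and "\<And>k. k \<in> J \<Longrightarrow> 0 \<le> t k" and "\<And>k. k \<in> J \<Longrightarrow> 0 \<le> p k" and "\<And>k. k \<in> J \<Longrightarrow> 0 \<le> q k"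
    and "AE x in M. (\<integral>\<^sup>+y. ennreal ((\<Sum>k\<in>J. t k / (p k * q k) * (\<phi> k x * \<phi> k y)) + r x * r' y / R) \<partial>N) = 1"
proof -
  note meas = meas'[rule_format] and nonneg = nonneg'[rule_format] and one = one'[rule_format]
  interpret M: prob_space M by fact
  interpret N: prob_space N by fact
  have space: "space N = space M" by (rule sets_eq_imp_space_eq[OF sets])
  have le1: "\<phi> k x \<le> 1" if "k \<in> J" "x \<in> space M" for k x
    using member_le_sum[OF that(1), of "\<lambda>k. \<phi> k x"] nonneg that one[OF that(2)] J by auto
  show iM: "integrable M (\<phi> k)" if "k \<in> J" for k
    by (rule M.integrable_const_bound[of _ 1]) (use meas nonneg le1 that in auto)
  show iN: "integrable N (\<phi> k)" if "k \<in> J" for k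
    by (rule N.integrable_const_bound[of _ 1])
       (use meas nonneg le1 that space in \<open>auto simp: measurable_cong_sets[OF sets refl]\<close>)
  show p0: "0 \<le> p k" if "k \<in> J" for k
    unfolding p by (rule integral_nonneg_AE) (use nonneg that in auto)
  show q0: "0 \<le> q k" if "k \<in> J" for k
    unfolding q by (rule integral_nonneg_AE) (use nonneg that space in auto)
  show t0: "0 \<le> t k" if "k \<in> J" for k
    using p0 q0 that by (simp add: t)
  \<comment> \<open>If \<open>p k\<close> or \<open>q k\<close> is 0, then so is \<open>t k\<close>,
    and division by zero does no harm.\<close>
  have tp: "t k / p k * p k = t k" and tq: "t k / q k * q k = t k" if "k \<in> J" for k
    using p0[OF that] q0[OF that] by (auto simp: t min_def)
  have tp1: "t k / p k \<le> 1" and tq1: "t k / q k \<le> 1" if "k \<in> J" for k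
    using p0[OF that] q0[OF that] by (auto simp: t min_def divide_le_eq_1)
  have tp0: "0 \<le> t k / p k" and tq0: "0 \<le> t k / q k" if "k \<in> J" for k
    using t0 p0 q0 that by auto
  show r0: "0 \<le> r x" if x: "x \<in> space M" for x
  proof -
    have "(\<Sum>k\<in>J. t k / p k * \<phi> k x) \<le> (\<Sum>k\<in>J. \<phi> k x)"
      by (intro sum_mono mult_left_le_one_le nonneg tp0 tp1 x)
    then show ?thesis using one[OF x] by (simp add: r)
  qed
  show r'0: "0 \<le> r' x" if x: "x \<in> space M" for x
  proof -
    have "(\<Sum>k\<in>J. t k / q k * \<phi> k x) \<le> (\<Sum>k\<in>J. \<phi> k x)"
      by (intro sum_mono mult_left_le_one_le nonneg tq0 tq1 x)
    then show ?thesis using one[OF x] by (simp add: r')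
  qed
  show ir: "integrable M r"
    unfolding r[abs_def] by (intro Bochner_Integration.integrable_diff Bochner_Integration.integrable_sum
        integrable_mult_right iM) auto
  show ir': "integrable N r'"
    unfolding r'[abs_def] by (intro Bochner_Integration.integrable_diff Bochner_Integration.integrable_sum
        integrable_mult_right iN) auto
  have "(\<integral>x. r x \<partial>M) = 1 - (\<Sum>k\<in>J. t k / p k * p k)"
    unfolding r using iM by (subst Bochner_Integration.integral_diff)
      (auto simp: p[symmetric] M.prob_space Bochner_Integration.integral_sum)
  then show Rr: "(\<integral>x. r x \<partial>M) = R" using tp by (simp add: R)
  have "(\<integral>x. r' x \<partial>N) = 1 - (\<Sum>k\<in>J. t k / q k * q k)"
    unfolding r' using iN by (subst Bochner_Integration.integral_diff)
      (auto simp: q[symmetric] N.prob_space Bochner_Integration.integral_sum)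
  then show Rr': "(\<integral>x. r' x \<partial>N) = R" using tq by (simp add: R)
  show R0: "0 \<le> R"
    unfolding Rr[symmetric] by (rule integral_nonneg_AE) (use r0 in auto)
  \<comment> \<open>For \<open>R = 0\<close> division by zero deletes the independent part. This is
    correct because \<open>r\<close> then vanishes almost everywhere, and it is why the marginal
    identity is claimed only almost everywhere.\<close>
  have "AE x in M. R = 0 \<longrightarrow> r x = 0"
  proof (cases "R = 0")
    case True
    then have "AE x in M. r x = 0"
      using integral_nonneg_eq_0_iff_AE[OF ir] r0 Rr by auto
    then show ?thesis by auto
  qed simp
  then show "AE x in M. (\<integral>\<^sup>+y. ennreal ((\<Sum>k\<in>J. t k / (p k * q k) * (\<phi> k x * \<phi> k y)) + r x * r' y / R) \<partial>N) = 1"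
    using AE_space
  proof eventually_elim
    case (elim x)
    have coef: "t k / (p k * q k) * q k = t k / p k" if "k \<in> J" for k
      using tq[OF that] by (auto simp: field_simps)
    have i1: "integrable N (\<lambda>y. \<Sum>k\<in>J. t k / (p k * q k) * (\<phi> k x * \<phi> k y))"
      by (intro Bochner_Integration.integrable_sum integrable_mult_right iN)
    have i2: "integrable N (\<lambda>y. r x * r' y / R)"
      by (intro integrable_divide integrable_mult_right ir')
    have nn: "0 \<le> (\<Sum>k\<in>J. t k / (p k * q k) * (\<phi> k x * \<phi> k y)) + r x * r' y / R" if "y \<in> space M" for y
      by (intro add_nonneg_nonneg sum_nonneg mult_nonneg_nonneg divide_nonneg_nonneg t0 p0 q0 nonneg r0 r'0 R0 that elim)
    have "(\<integral>\<^sup>+y. ennreal ((\<Sum>k\<in>J. t k / (p k * q k) * (\<phi> k x * \<phi> k y)) + r x * r' y / R) \<partial>N)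
        = ennreal (\<integral>y. (\<Sum>k\<in>J. t k / (p k * q k) * (\<phi> k x * \<phi> k y)) + r x * r' y / R \<partial>N)"
      by (rule nn_integral_eq_integral[OF Bochner_Integration.integrable_add[OF i1 i2]]) (use nn space in auto)
    also have "(\<integral>y. (\<Sum>k\<in>J. t k / (p k * q k) * (\<phi> k x * \<phi> k y)) + r x * r' y / R \<partial>N)
        = (\<Sum>k\<in>J. t k / (p k * q k) * (\<phi> k x * q k)) + r x * R / R"
      using i1 i2 iN by (subst Bochner_Integration.integral_add)
        (auto simp: Bochner_Integration.integral_sum q[symmetric] Rr')
    also have "(\<Sum>k\<in>J. t k / (p k * q k) * (\<phi> k x * q k)) = (\<Sum>k\<in>J. t k / p k * \<phi> k x)"
    proof (rule sum.cong)
      fix k assume k: "k \<in> J"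
      have "t k / (p k * q k) * (\<phi> k x * q k) = (t k / (p k * q k) * q k) * \<phi> k x"
        by (simp only: ac_simps)
      then show "t k / (p k * q k) * (\<phi> k x * q k) = t k / p k * \<phi> k x"
        by (simp only: coef[OF k])
    qed simp
    also have "r x * R / R = r x" using elim by auto
    finally show ?case by (simp add: r)
  qed
qed

text \<open>The two marginals are matched on each piece \<open>\<phi> k\<close> of a partition of unity up to the common
  mass \<open>min (p k) (q k)\<close>, and the remaining masses are coupled independently. The part \<open>wb\<close>, which
  may move mass far, consists of the remainder and of the piece \<open>k0\<close> at infinity.\<close>

lemma transport_weights:
  fixes \<phi> :: "'k \<Rightarrow> 'b \<Rightarrow> real"
  assumes M: "prob_space M" and N: "prob_space N" and sets: "sets N = sets M"
    and J: "finite J" and k0: "k0 \<in> J"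
    and meas: "\<And>k. k \<in> J \<Longrightarrow> \<phi> k \<in> borel_measurable M"
    and nonneg: "\<And>k x. k \<in> J \<Longrightarrow> x \<in> space M \<Longrightarrow> 0 \<le> \<phi> k x"
    and one: "\<And>x. x \<in> space M \<Longrightarrow> (\<Sum>k\<in>J. \<phi> k x) = 1"
  obtains wg wb :: "'b \<Rightarrow> 'b \<Rightarrow> real"
  where "(\<lambda>(x, y). wg x y) \<in> borel_measurable (M \<Otimes>\<^sub>M N)" "(\<lambda>(x, y). wb x y) \<in> borel_measurable (M \<Otimes>\<^sub>M N)"
    and "\<And>x y. x \<in> space M \<Longrightarrow> y \<in> space M \<Longrightarrow> 0 \<le> wg x y"
    and "\<And>x y. x \<in> space M \<Longrightarrow> y \<in> space M \<Longrightarrow> 0 \<le> wb x y"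
    and "AE x in M. (\<integral>\<^sup>+y. ennreal (wg x y + wb x y) \<partial>N) = 1"
    and "AE y in N. (\<integral>\<^sup>+x. ennreal (wg x y + wb x y) \<partial>M) = 1"
    and "\<And>x y. wg x y \<noteq> 0 \<Longrightarrow> \<exists>k\<in>J - {k0}. \<phi> k x \<noteq> 0 \<and> \<phi> k y \<noteq> 0"
    and "(\<integral>\<^sup>+x. \<integral>\<^sup>+y. ennreal (wb x y) \<partial>N \<partial>M)
           \<le> ennreal ((\<integral>x. \<phi> k0 x \<partial>M) + (\<Sum>k\<in>J. \<bar>(\<integral>x. \<phi> k x \<partial>M) - (\<integral>x. \<phi> k x \<partial>N)\<bar>))"
proof -
  interpret M: prob_space M by fact
  interpret N: prob_space N by fact
  have space: "space N = space M" by (rule sets_eq_imp_space_eq[OF sets])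
  define p where "p k = (\<integral>x. \<phi> k x \<partial>M)" for k
  define q where "q k = (\<integral>x. \<phi> k x \<partial>N)" for k
  define t where "t k = min (p k) (q k)" for k
  define r where "r x = 1 - (\<Sum>k\<in>J. t k / p k * \<phi> k x)" for x
  define r' where "r' x = 1 - (\<Sum>k\<in>J. t k / q k * \<phi> k x)" for x
  define R where "R = 1 - (\<Sum>k\<in>J. t k)"
  have m: "\<forall>k\<in>J. \<phi> k \<in> borel_measurable M" and n: "\<forall>k\<in>J. \<forall>x\<in>space M. 0 \<le> \<phi> k x"
    and o: "\<forall>x\<in>space M. (\<Sum>k\<in>J. \<phi> k x) = 1"
    using meas nonneg one by auto
  note W = transport_weight_marginal[OF M N sets J m n o p_def q_def t_def r_def r'_def R_def]
  define wg where "wg x y = (\<Sum>k\<in>J - {k0}. t k / (p k * q k) * (\<phi> k x * \<phi> k y))" for x y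
  define wb where "wb x y = t k0 / (p k0 * q k0) * (\<phi> k0 x * \<phi> k0 y) + r x * r' y / R" for x y
  have split: "wg x y + wb x y = (\<Sum>k\<in>J. t k / (p k * q k) * (\<phi> k x * \<phi> k y)) + r x * r' y / R" for x y
    unfolding wg_def wb_def using sum.remove[OF J k0, of "\<lambda>k. t k / (p k * q k) * (\<phi> k x * \<phi> k y)"] by simp
  have measN: "\<And>k. k \<in> J \<Longrightarrow> \<phi> k \<in> borel_measurable N"
    using meas by (simp add: measurable_cong_sets[OF sets refl])
  have t_sym: "\<And>k. t k = min (q k) (p k)" by (simp add: t_def min.commute)
  have W': "AE y in N. (\<integral>\<^sup>+x. ennreal ((\<Sum>k\<in>J. t k / (q k * p k) * (\<phi> k y * \<phi> k x)) + r' y * r x / R) \<partial>M) = 1"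
    by (rule transport_weight_marginal(13)[OF N M sets[symmetric] J _ _ _ q_def p_def t_sym r'_def r_def R_def])
       (use measN nonneg one space in auto)
  have mf: "(\<lambda>z. \<phi> k (fst z)) \<in> borel_measurable (M \<Otimes>\<^sub>M N)"
    and ms: "(\<lambda>z. \<phi> k (snd z)) \<in> borel_measurable (M \<Otimes>\<^sub>M N)" if "k \<in> J" for k
    using meas[OF that] measN[OF that] by measurable
  show thesis
  proof
    show "(\<lambda>(x, y). wg x y) \<in> borel_measurable (M \<Otimes>\<^sub>M N)"
      unfolding wg_def case_prod_unfold by (intro borel_measurable_sum borel_measurable_times mf ms) auto
    show "(\<lambda>(x, y). wb x y) \<in> borel_measurable (M \<Otimes>\<^sub>M N)"
      unfolding wb_def r_def r'_def case_prod_unfold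
      by (intro borel_measurable_sum borel_measurable_times borel_measurable_add borel_measurable_divide
          borel_measurable_diff mf ms k0) auto
    show "0 \<le> wg x y" if "x \<in> space M" "y \<in> space M" for x y
      unfolding wg_def by (intro sum_nonneg mult_nonneg_nonneg divide_nonneg_nonneg W(10,11,12) nonneg that) auto
    show wb0: "0 \<le> wb x y" if "x \<in> space M" "y \<in> space M" for x y
      unfolding wb_def
      by (intro add_nonneg_nonneg mult_nonneg_nonneg divide_nonneg_nonneg W(1,2,3,10,11,12) nonneg that k0)
    show "AE x in M. (\<integral>\<^sup>+y. ennreal (wg x y + wb x y) \<partial>N) = 1"
      unfolding split by (rule W(13))
    show "AE y in N. (\<integral>\<^sup>+x. ennreal (wg x y + wb x y) \<partial>M) = 1"
      unfolding split using W' by (simp add: mult.commute)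
    show "\<exists>k\<in>J - {k0}. \<phi> k x \<noteq> 0 \<and> \<phi> k y \<noteq> 0" if nz: "wg x y \<noteq> 0" for x y
    proof (rule ccontr)
      assume "\<not> ?thesis"
      then have "wg x y = 0" unfolding wg_def by (intro sum.neutral) auto
      then show False using nz by simp
    qed
    \<comment> \<open>Integrating out y leaves at most \<open>\<phi> k0 x + r x\<close>, hence a
      total of at most \<open>p k0 + R\<close>, where \<open>R\<close> is the sum of the unmatched
      masses \<open>p k - t k\<close>.\<close>
    have "(\<integral>\<^sup>+x. \<integral>\<^sup>+y. ennreal (wb x y) \<partial>N \<partial>M) \<le> (\<integral>\<^sup>+x. ennreal (\<phi> k0 x + r x) \<partial>M)"
    proof (rule nn_integral_mono)
      fix x assume x: "x \<in> space M"
      have i: "integrable N (\<lambda>y. wb x y)"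
        unfolding wb_def by (intro Bochner_Integration.integrable_add integrable_mult_right integrable_divide W(5,9) k0)
      have "(\<integral>\<^sup>+y. ennreal (wb x y) \<partial>N) = ennreal (\<integral>y. wb x y \<partial>N)"
        by (rule nn_integral_eq_integral[OF i]) (use wb0 x space in auto)
      also have "(\<integral>y. wb x y \<partial>N) = t k0 / (p k0 * q k0) * (\<phi> k0 x * q k0) + r x * R / R"
        unfolding wb_def using W(5,7,9) k0 by (subst Bochner_Integration.integral_add) (auto simp: q_def[symmetric])
      also have "\<dots> \<le> \<phi> k0 x + r x"
      proof (rule add_mono)
        have "t k0 / (p k0 * q k0) * (\<phi> k0 x * q k0) = (t k0 / p k0) * (q k0 / q k0) * \<phi> k0 x"
          by simp
        also have "\<dots> \<le> 1 * 1 * \<phi> k0 x"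
          using W(11,12)[OF k0] nonneg[OF k0 x] W(10)[OF k0]
          by (intro mult_mono) (auto simp: t_def min_def divide_le_eq_1)
        finally show "t k0 / (p k0 * q k0) * (\<phi> k0 x * q k0) \<le> \<phi> k0 x" by simp
        show "r x * R / R \<le> r x" using W(2)[OF x] by (cases "R = 0") auto
      qed
      finally show "(\<integral>\<^sup>+y. ennreal (wb x y) \<partial>N) \<le> ennreal (\<phi> k0 x + r x)"
        by (simp add: ennreal_leI)
    qed
    also have "\<dots> = ennreal (\<integral>x. \<phi> k0 x + r x \<partial>M)"
      by (rule nn_integral_eq_integral[OF Bochner_Integration.integrable_add[OF W(8)[OF k0] W(4)]])
         (use nonneg[OF k0] W(2) in auto)
    also have "(\<integral>x. \<phi> k0 x + r x \<partial>M) = p k0 + R"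
      using W(4,6,8) k0 by (simp add: p_def)
    also have "R \<le> (\<Sum>k\<in>J. \<bar>p k - q k\<bar>)"
    proof -
      have "1 = (\<integral>x. (\<Sum>k\<in>J. \<phi> k x) \<partial>M)"
        using one M.prob_space by (simp cong: Bochner_Integration.integral_cong)
      also have "\<dots> = (\<Sum>k\<in>J. p k)"
        unfolding p_def by (rule Bochner_Integration.integral_sum) (rule W(8))
      finally have "R = (\<Sum>k\<in>J. p k - t k)"
        by (simp add: R_def sum_subtractf)
      also have "\<dots> \<le> (\<Sum>k\<in>J. \<bar>p k - q k\<bar>)"
        by (rule sum_mono) (auto simp: t_def)
      finally show ?thesis .
    qed
    finally show "(\<integral>\<^sup>+x. \<integral>\<^sup>+y. ennreal (wb x y) \<partial>N \<partial>M)
           \<le> ennreal ((\<integral>x. \<phi> k0 x \<partial>M) + (\<Sum>k\<in>J. \<bar>(\<integral>x. \<phi> k x \<partial>M) - (\<integral>x. \<phi> k x \<partial>N)\<bar>))"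
      unfolding p_def q_def by (simp add: ennreal_leI)
  qed
qed

section \<open>Continuity of the transport cost relative to the reference moment\<close>

text \<open>By uniform continuity, each point of K has a ball on which \<open>h x\<close> is nearly
  constant, uniformly for x in the compact set KX; finitely many such balls cover K. The index
  \<open>None\<close> is the piece at infinity.\<close>

lemma partition_of_unity_near_compact:
  fixes h :: "'a::euclidean_space \<Rightarrow> 'a \<Rightarrow> real"
  assumes KX: "compact KX" "KX \<subseteq> X" and K: "compact K" "K \<subseteq> Y" "K \<noteq> {}" and Y: "open Y"
    and h: "continuous_on (X \<times> Y) (\<lambda>z. h (fst z) (snd z))" and \<epsilon>: "\<epsilon> > 0"
  obtains J :: "'a option set" and \<phi> :: "'a option \<Rightarrow> 'a \<Rightarrow> real"
  where "finite J" "None \<in> J" "\<And>k. k \<in> J \<Longrightarrow> continuous_on Y (\<phi> k)"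
    and "\<And>k y. k \<in> J \<Longrightarrow> 0 \<le> \<phi> k y" "\<And>y. (\<Sum>k\<in>J. \<phi> k y) = 1" "\<And>y. y \<in> K \<Longrightarrow> \<phi> None y = 0"
    and "\<And>k x y y'. k \<in> J - {None} \<Longrightarrow> x \<in> KX \<Longrightarrow> y \<in> Y \<Longrightarrow> y' \<in> Y \<Longrightarrow> \<phi> k y \<noteq> 0 \<Longrightarrow> \<phi> k y' \<noteq> 0
           \<Longrightarrow> \<bar>h x y - h x y'\<bar> \<le> \<epsilon>"
proof -
  have "\<exists>\<rho>>0. \<forall>x\<in>KX. \<forall>y. dist v y < \<rho> \<longrightarrow> \<bar>h x y - h x v\<bar> \<le> \<epsilon> / 2" if v: "v \<in> K" for v
  proof -
    obtain r where r: "r > 0" "cball v r \<subseteq> Y"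
      using Y v K(2) open_contains_cball by blast
    have "uniformly_continuous_on (KX \<times> cball v r) (\<lambda>z. h (fst z) (snd z))"
      by (intro compact_uniformly_continuous compact_Times KX(1) compact_cball continuous_on_subset[OF h])
         (use KX r in auto)
    then obtain d where d: "d > 0"
      "\<And>z z'. z \<in> KX \<times> cball v r \<Longrightarrow> z' \<in> KX \<times> cball v r \<Longrightarrow> dist z' z < d
        \<Longrightarrow> dist (h (fst z') (snd z')) (h (fst z) (snd z)) < \<epsilon> / 2"
      unfolding uniformly_continuous_on_def using \<epsilon> by (metis half_gt_zero)
    have "\<bar>h x y - h x v\<bar> \<le> \<epsilon> / 2" if "x \<in> KX" "dist v y < min r d" for x y
      using d(2)[of "(x, v)" "(x, y)"] that r(1) by (auto simp: dist_Pair_Pair dist_commute dist_real_def abs_minus_commute)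
    then show ?thesis using r(1) d(1) by (intro exI[of _ "min r d"]) auto
  qed
  then obtain \<rho> where \<rho>: "\<And>v. v \<in> K \<Longrightarrow> \<rho> v > 0"
    "\<And>v x y. v \<in> K \<Longrightarrow> x \<in> KX \<Longrightarrow> dist v y < \<rho> v \<Longrightarrow> \<bar>h x y - h x v\<bar> \<le> \<epsilon> / 2"
    by metis
  have cover: "K \<subseteq> (\<Union>v\<in>K. ball v (\<rho> v))"
  proof
    fix v assume "v \<in> K"
    then show "v \<in> (\<Union>v\<in>K. ball v (\<rho> v))" using \<rho>(1)[of v] by (intro UN_I[of v]) auto
  qed
  obtain T where T: "T \<subseteq> K" "finite T" "K \<subseteq> (\<Union>v\<in>T. ball v (\<rho> v))"
    using compactE_image[OF K(1) _ cover] by (metis open_ball)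
  define J where "J = insert None (Some ` T)"
  \<comment> \<open>Cones on the chosen balls, and the distance to K at infinity. The distance is
    positive exactly off K, so it vanishes where it must and the sum \<open>S\<close> is positive
    everywhere.\<close>
  define \<psi> where "\<psi> k y = (case k of None \<Rightarrow> infdist y K | Some v \<Rightarrow> max 0 (\<rho> v - dist v y))" for k y
  define S where "S y = (\<Sum>k\<in>J. \<psi> k y)" for y
  have finJ: "finite J" using T(2) by (simp add: J_def)
  have \<psi>0: "0 \<le> \<psi> k y" for k y by (simp add: \<psi>_def infdist_nonneg split: option.split)
  have S: "S y > 0" for y
  proof -
    have "\<exists>k\<in>J. \<psi> k y > 0"
    proof (cases "y \<in> K")
      case True
      then obtain v where "v \<in> T" "dist v y < \<rho> v" using T(3) by auto
      then show ?thesis by (intro bexI[of _ "Some v"]) (auto simp: \<psi>_def J_def)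
    next
      case False
      then have "infdist y K \<noteq> 0"
        using in_closed_iff_infdist_zero[OF compact_imp_closed[OF K(1)] K(3)] by blast
      then show ?thesis using infdist_nonneg[of y K] by (intro bexI[of _ None]) (auto simp: \<psi>_def J_def)
    qed
    then show ?thesis unfolding S_def using sum_pos2[OF finJ, of _ "\<lambda>k. \<psi> k y"] \<psi>0 by blast
  qed
  have cont\<psi>: "continuous_on Y (\<psi> k)" for k
    unfolding \<psi>_def[abs_def] by (cases k) (auto intro!: continuous_intros)
  show thesis
  proof (rule that[of J "\<lambda>k y. \<psi> k y / S y"])
    show "continuous_on Y (\<lambda>y. \<psi> k y / S y)" if "k \<in> J" for k
      using S by (intro continuous_on_divide cont\<psi>) (auto simp: S_def[abs_def] less_imp_neq[symmetric] intro!: continuous_on_sum cont\<psi>)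
    show "(\<Sum>k\<in>J. \<psi> k y / S y) = 1" for y
      using S[of y] by (simp add: sum_divide_distrib[symmetric] S_def[symmetric])
    fix k x y y'
    assume k: "k \<in> J - {None}" and x: "x \<in> KX" and nz: "\<psi> k y / S y \<noteq> 0" "\<psi> k y' / S y' \<noteq> 0"
    then obtain v where v: "k = Some v" "v \<in> T" by (auto simp: J_def)
    then have "dist v y < \<rho> v" "dist v y' < \<rho> v"
      using nz by (auto simp: \<psi>_def max_def split: if_splits)
    moreover have "v \<in> K" using v T(1) by blast
    ultimately have "\<bar>h x y - h x v\<bar> \<le> \<epsilon> / 2" "\<bar>h x y' - h x v\<bar> \<le> \<epsilon> / 2"
      using \<rho>(2) x by blast+
    then show "\<bar>h x y - h x y'\<bar> \<le> \<epsilon>" by linarith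
  qed (use finJ \<psi>0 S in \<open>auto simp: J_def \<psi>_def less_imp_le\<close>)
qed

section \<open>Consequences of the standing assumptions, and stability of the transport cost\<close>

locale transport_cost =
  fixes X Y :: "'a::euclidean_space set" and c :: "'a \<Rightarrow> 'a \<Rightarrow> real" and x0 y0 :: 'a
  assumes std: "standing_assumptions X Y c x0 y0"
begin

abbreviation moment :: "'a measure \<Rightarrow> ennreal" where
  "moment \<nu> \<equiv> \<integral>\<^sup>+ y. ennreal (c x0 y) \<partial>\<nu>"

lemma basic:
  shows "open X" "open Y" "x0 \<in> X" "y0 \<in> Y" and c_nonneg: "\<And>x y. x \<in> X \<Longrightarrow> y \<in> Y \<Longrightarrow> 0 \<le> c x y"
    and compact_X: "\<And>b y. y \<in> Y \<Longrightarrow> compact {x\<in>X. c x y \<le> b}"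
    and compact_Y: "\<And>b x. x \<in> X \<Longrightarrow> compact {y\<in>Y. c x y \<le> b}"
  using std unfolding standing_assumptions_def by auto

lemma c_continuous: "continuous_on (X \<times> Y) (\<lambda>z. c (fst z) (snd z))"
proof -
  have "C2_on (X \<times> Y) (\<lambda>z. c (fst z) (snd z))"
    using std unfolding standing_assumptions_def by auto
  then show ?thesis
    unfolding C2_on_def by (metis (no_types, lifting) continuous_at_imp_continuous_on has_derivative_continuous)
qed

lemma c_continuous_x: "y \<in> Y \<Longrightarrow> continuous_on X (\<lambda>x. c x y)"
  and c_continuous_y: "x \<in> X \<Longrightarrow> continuous_on Y (c x)"
proof -
  show "y \<in> Y \<Longrightarrow> continuous_on X (\<lambda>x. c x y)"
    using continuous_on_compose2[OF c_continuous, of X "\<lambda>x. (x, y)"]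
    by (simp add: continuous_on_Pair image_subset_iff)
  show "x \<in> X \<Longrightarrow> continuous_on Y (c x)"
    using continuous_on_compose2[OF c_continuous, of Y "\<lambda>y. (x, y)"]
    by (simp add: continuous_on_Pair image_subset_iff)
qed

lemma cost_near_reference:
  assumes "\<epsilon> > 0"
  obtains B where "B > 0" "\<And>x y. x \<in> X \<Longrightarrow> y \<in> Y \<Longrightarrow> \<bar>c x y - c x0 y\<bar> \<le> \<epsilon> * c x0 y + B * c x y0"
proof -
  obtain B where "B > 0" and B: "\<forall>x\<in>X. \<forall>y\<in>Y. (1 - \<epsilon>) * c x0 y - B * c x y0 \<le> c x y \<and> c x y \<le> (1 + \<epsilon>) * c x0 y + B * c x y0"
    using std assms unfolding standing_assumptions_def by meson
  then show thesis by (intro that[of B]) (auto simp: abs_le_iff algebra_simps)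
qed

lemma Pcost_XD:
  assumes "\<mu> \<in> Pcost_X X c y0"
  shows "\<mu> \<in> Prob X" "(\<integral>\<^sup>+ x. ennreal (c x y0) \<partial>\<mu>) < \<infinity>" "(\<lambda>x. c x y0) \<in> borel_measurable \<mu>"
  using assms continuous_on_measurable_Prob[of \<mu> X, OF _ c_continuous_x[OF basic(4)]]
  by (auto simp: Pcost_X_def)

lemma Pcost_YD:
  assumes "\<nu> \<in> Pcost_Y Y c x0"
  shows "\<nu> \<in> Prob Y" "moment \<nu> < \<infinity>" "c x0 \<in> borel_measurable \<nu>"
  using assms continuous_on_measurable_Prob[of \<nu> Y, OF _ c_continuous_y[OF basic(3)]]
  by (auto simp: Pcost_Y_def)

text \<open>The level \<open>M\<close> separates the x in a compact sublevel set, where estimates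
  are uniform, from those whose cost is charged to the integrable tail.\<close>

lemma tail_moment_small:
  assumes \<mu>: "\<mu> \<in> Pcost_X X c y0" and e: "e > 0"
  obtains M :: real where "M > 0" "(\<integral>\<^sup>+ x. ennreal (if M < c x y0 then c x y0 else 0) \<partial>\<mu>) \<le> ennreal e"
proof -
  note [measurable] = Pcost_XD(3)[OF \<mu>]
  have "(\<lambda>n. \<integral>\<^sup>+ x. ennreal (if real n < c x y0 then c x y0 else 0) \<partial>\<mu>) \<longlonglongrightarrow> (\<integral>\<^sup>+ x. 0 \<partial>\<mu>)"
  proof (rule nn_integral_dominated_convergence[where w="\<lambda>x. ennreal (c x y0)"])
    show "AE x in \<mu>. (\<lambda>n. ennreal (if real n < c x y0 then c x y0 else 0)) \<longlonglongrightarrow> 0"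
    proof (rule AE_I2)
      fix x
      obtain N where "c x y0 < real N" using reals_Archimedean2 by blast
      then have "\<forall>\<^sub>F n in sequentially. ennreal (if real n < c x y0 then c x y0 else 0) = 0"
        unfolding eventually_sequentially by (intro exI[of _ N]) auto
      then show "(\<lambda>n. ennreal (if real n < c x y0 then c x y0 else 0)) \<longlonglongrightarrow> 0"
        by (rule tendsto_eventually)
    qed
  qed (use Pcost_XD[OF \<mu>] in \<open>auto intro!: AE_I2 ennreal_leI\<close>)
  then have "\<forall>\<^sub>F n in sequentially. (\<integral>\<^sup>+ x. ennreal (if real n < c x y0 then c x y0 else 0) \<partial>\<mu>) < ennreal e"
    by (rule order_tendstoD) (use e in simp)
  then have "\<forall>\<^sub>F n in sequentially. (\<integral>\<^sup>+ x. ennreal (if real n < c x y0 then c x y0 else 0) \<partial>\<mu>) < ennreal e \<and> n \<ge> 1"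
    using eventually_ge_at_top by (rule eventually_conj)
  then obtain n where "(\<integral>\<^sup>+ x. ennreal (if real n < c x y0 then c x y0 else 0) \<partial>\<mu>) < ennreal e" "n \<ge> 1"
    using eventually_happens' sequentially_bot by blast
  then show thesis by (intro that[of "real n"]) auto
qed


lemma cost_measurable:
  shows "(\<lambda>z. c (fst z) (snd z)) \<in> borel_measurable (restrict_space borel (X \<times> Y))"
    and "\<pi> \<in> Prob (X \<times> Y) \<Longrightarrow> (\<lambda>z. c (fst z) (snd z)) \<in> borel_measurable \<pi>"
  using borel_measurable_continuous_on_restrict[OF c_continuous] continuous_on_measurable_Prob[OF _ c_continuous]
  by auto

text \<open>One half of the continuity of cost minus moment, with the moments moved across the
  inequality to stay in \<open>ennreal\<close>. The test functions depend on \<mu>, e and C but not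
  on \<nu> and \<nu>', so a weakly convergent sequence eventually satisfies the condition;
  exchanging \<nu> and \<nu>' gives the other half.\<close>

lemma transport_cost_stable:
  assumes \<mu>: "\<mu> \<in> Pcost_X X c y0" and e: "e > 0" and C: "C > 0"
  obtains J :: "'a option set" and \<phi> :: "'a option \<Rightarrow> 'a \<Rightarrow> real" and \<eta> :: real
  where "finite J" "\<And>k. k \<in> J \<Longrightarrow> continuous_on Y (\<phi> k)" "\<And>k. k \<in> J \<Longrightarrow> bounded (\<phi> k ` Y)" "\<eta> > 0"
    and "\<And>\<nu> \<nu>'. \<nu> \<in> Pcost_Y Y c x0 \<Longrightarrow> \<nu>' \<in> Pcost_Y Y c x0 \<Longrightarrow> moment \<nu> \<le> ennreal C \<Longrightarrow> moment \<nu>' \<le> ennreal C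
          \<Longrightarrow> (\<Sum>k\<in>J. \<bar>(\<integral>y. \<phi> k y \<partial>\<nu>) - (\<integral>y. \<phi> k y \<partial>\<nu>')\<bar>) \<le> \<eta>
          \<Longrightarrow> Kc X Y c \<mu> \<nu>' + moment \<nu> \<le> Kc X Y c \<mu> \<nu> + moment \<nu>' + ennreal e"
proof -
  \<comment> \<open>The error budget: \<epsilon> is spent once by itself and once against each of
    the two moments, and \<epsilon> (1 + 2 C) = e/2. The tail of \<mu> has factor 2 B and costs e/4.
    The badly moved mass, at most 2 \<eta>, has factor 2 B M and costs e/4.\<close>
  define \<epsilon> where "\<epsilon> = e / (2 * (1 + 2 * C))"
  have \<epsilon>: "\<epsilon> > 0" using e C by (simp add: \<epsilon>_def)
  obtain B where B: "B > 0" and near: "\<And>x y. x \<in> X \<Longrightarrow> y \<in> Y \<Longrightarrow> \<bar>c x y - c x0 y\<bar> \<le> \<epsilon> * c x0 y + B * c x y0"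
    using cost_near_reference[OF \<epsilon>] by blast
  obtain M where M: "M > 0"
    and tail: "(\<integral>\<^sup>+ x. ennreal (if M < c x y0 then c x y0 else 0) \<partial>\<mu>) \<le> ennreal (e / (8 * B))"
    using tail_moment_small[OF \<mu>, of "e / (8 * B)"] e B by auto
  define \<eta> where "\<eta> = e / (16 * B * M)"
  have \<eta>: "\<eta> > 0" using e B M by (simp add: \<eta>_def)
  \<comment> \<open>The first entry puts \<open>y0\<close> into the compact set, which is thus
    nonempty; the second brings the Markov bound \<open>C / b\<close> for the mass outside below
    \<eta>.\<close>
  define b where "b = max (c x0 y0) (C / \<eta>)"
  have b: "b > 0" "C / b \<le> \<eta>"
  proof -
    have "C / \<eta> > 0" using C \<eta> by simp
    moreover have "C / \<eta> \<le> b" by (simp add: b_def)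
    ultimately show "b > 0" by linarith
    then show "C / b \<le> \<eta>" using \<open>C / \<eta> \<le> b\<close> \<eta> by (simp add: field_simps)
  qed
  have hcont: "continuous_on (X \<times> Y) (\<lambda>z. c (fst z) (snd z) - c x0 (snd z))"
    using basic(3) by (intro continuous_on_diff c_continuous continuous_on_compose2[OF c_continuous_y[OF basic(3)]])
      (auto intro!: continuous_intros)
  have y0K: "{y\<in>Y. c x0 y \<le> b} \<noteq> {}"
    using basic(4) by (auto simp: b_def)
  show thesis
  proof (rule partition_of_unity_near_compact[where h="\<lambda>x y. c x y - c x0 y",
        OF compact_X[OF basic(4), of M] Collect_restrict compact_Y[OF basic(3), of b] Collect_restrict y0K basic(2) hcont \<epsilon>])
    fix J :: "'a option set" and \<phi> :: "'a option \<Rightarrow> 'a \<Rightarrow> real"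
    assume J: "finite J" "None \<in> J" and \<phi>c: "\<And>k. k \<in> J \<Longrightarrow> continuous_on Y (\<phi> k)"
      and \<phi>0: "\<And>k y. k \<in> J \<Longrightarrow> 0 \<le> \<phi> k y" and \<phi>1: "\<And>y. (\<Sum>k\<in>J. \<phi> k y) = 1"
      and \<phi>N: "\<And>y. y \<in> {y\<in>Y. c x0 y \<le> b} \<Longrightarrow> \<phi> None y = 0"
      and \<phi>h: "\<And>k x y y'. k \<in> J - {None} \<Longrightarrow> x \<in> {x\<in>X. c x y0 \<le> M} \<Longrightarrow> y \<in> Y \<Longrightarrow> y' \<in> Y \<Longrightarrow> \<phi> k y \<noteq> 0 \<Longrightarrow> \<phi> k y' \<noteq> 0
             \<Longrightarrow> \<bar>(c x y - c x0 y) - (c x y' - c x0 y')\<bar> \<le> \<epsilon>"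
    have \<phi>le: "\<phi> k y \<le> 1" if "k \<in> J" for k y
      using member_le_sum[OF that, of "\<lambda>k. \<phi> k y"] \<phi>0 \<phi>1 J by auto
    show thesis
    proof (rule that[OF J(1) \<phi>c _ \<eta>])
      show "bounded (\<phi> k ` Y)" if "k \<in> J" for k
        unfolding bounded_iff using \<phi>0[OF that] \<phi>le[OF that] by (intro exI[of _ 1]) auto
      fix \<nu> \<nu>'
      assume \<nu>: "\<nu> \<in> Pcost_Y Y c x0" and \<nu>': "\<nu>' \<in> Pcost_Y Y c x0"
        and mC: "moment \<nu> \<le> ennreal C" "moment \<nu>' \<le> ennreal C"
        and close: "(\<Sum>k\<in>J. \<bar>(\<integral>y. \<phi> k y \<partial>\<nu>) - (\<integral>y. \<phi> k y \<partial>\<nu>')\<bar>) \<le> \<eta>"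
      note \<nu>P = Pcost_YD(1)[OF \<nu>] and \<nu>'P = Pcost_YD(1)[OF \<nu>']
      interpret \<nu>: prob_space \<nu> using ProbD(1)[OF \<nu>P] .
      interpret \<nu>': prob_space \<nu>' using ProbD(1)[OF \<nu>'P] .
      have ss: "sets \<nu>' = sets \<nu>" by (simp add: ProbD(3)[OF \<nu>P] ProbD(3)[OF \<nu>'P])
      note sp [simp] = ProbD(2)[OF \<nu>P] ProbD(2)[OF \<nu>'P]
      show "Kc X Y c \<mu> \<nu>' + moment \<nu> \<le> Kc X Y c \<mu> \<nu> + moment \<nu>' + ennreal e"
      proof (rule transport_weights[OF \<nu>.prob_space_axioms \<nu>'.prob_space_axioms ss J, of \<phi>, unfolded sp])
        show "\<phi> k \<in> borel_measurable \<nu>" if "k \<in> J" for k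
          by (rule continuous_on_measurable_Prob[OF \<nu>P \<phi>c[OF that]])
        show "0 \<le> \<phi> k y" if "k \<in> J" for k y by (rule \<phi>0[OF that])
        show "(\<Sum>k\<in>J. \<phi> k y) = 1" for y by (rule \<phi>1)
        fix wg wb :: "'a \<Rightarrow> 'a \<Rightarrow> real"
        assume wm: "(\<lambda>(x, y). wg x y) \<in> borel_measurable (\<nu> \<Otimes>\<^sub>M \<nu>')" "(\<lambda>(x, y). wb x y) \<in> borel_measurable (\<nu> \<Otimes>\<^sub>M \<nu>')"
          and wg0: "\<And>x y. x \<in> Y \<Longrightarrow> y \<in> Y \<Longrightarrow> 0 \<le> wg x y"
          and wb0: "\<And>x y. x \<in> Y \<Longrightarrow> y \<in> Y \<Longrightarrow> 0 \<le> wb x y"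
          and w1: "AE x in \<nu>. (\<integral>\<^sup>+y. ennreal (wg x y + wb x y) \<partial>\<nu>') = 1"
          and w2: "AE y in \<nu>'. (\<integral>\<^sup>+x. ennreal (wg x y + wb x y) \<partial>\<nu>) = 1"
          and wg: "\<And>x y. wg x y \<noteq> 0 \<Longrightarrow> \<exists>k\<in>J - {None}. \<phi> k x \<noteq> 0 \<and> \<phi> k y \<noteq> 0"
          and wb: "(\<integral>\<^sup>+x. \<integral>\<^sup>+y. ennreal (wb x y) \<partial>\<nu>' \<partial>\<nu>)
               \<le> ennreal ((\<integral>x. \<phi> None x \<partial>\<nu>) + (\<Sum>k\<in>J. \<bar>(\<integral>x. \<phi> k x \<partial>\<nu>) - (\<integral>x. \<phi> k x \<partial>\<nu>')\<bar>))"
        have far: "(\<integral>y. \<phi> None y \<partial>\<nu>) \<le> \<eta>"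
        proof -
          have "ennreal (\<integral>y. \<phi> None y \<partial>\<nu>) = (\<integral>\<^sup>+y. ennreal (\<phi> None y) \<partial>\<nu>)"
            using \<phi>0[OF J(2)] \<phi>le[OF J(2)] continuous_on_measurable_Prob[OF \<nu>P \<phi>c[OF J(2)]]
            by (intro nn_integral_eq_integral[symmetric] \<nu>.integrable_const_bound[of _ 1]) auto
          also have "\<dots> \<le> (\<integral>\<^sup>+y. ennreal (1 / b) * ennreal (c x0 y) \<partial>\<nu>)"
          proof (rule nn_integral_mono)
            fix y assume "y \<in> space \<nu>"
            then have y: "y \<in> Y" by simp
            have "\<phi> None y \<le> 1 / b * c x0 y"
            proof (cases "c x0 y \<le> b")
              case True
              then show ?thesis using \<phi>N y c_nonneg[OF basic(3) y] b by simp
            next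
              case False
              then have "1 \<le> 1 / b * c x0 y" using b by simp
              then show ?thesis using \<phi>le[OF J(2), of y] by linarith
            qed
            then show "ennreal (\<phi> None y) \<le> ennreal (1 / b) * ennreal (c x0 y)"
              using b c_nonneg[OF basic(3) y] by (simp add: ennreal_mult[symmetric] ennreal_leI)
          qed
          also have "\<dots> = ennreal (1 / b) * moment \<nu>"
            using Pcost_YD(3)[OF \<nu>] by (intro nn_integral_cmult) simp
          also have "\<dots> \<le> ennreal (1 / b) * ennreal C" by (intro mult_left_mono mC) simp
          also have "\<dots> = ennreal (C / b)" using b C by (simp add: ennreal_mult[symmetric])
          also have "\<dots> \<le> ennreal \<eta>" using b by (simp add: ennreal_leI)
          finally show ?thesis using \<eta> by simp
        qed
        have bad: "(\<integral>\<^sup>+x. \<integral>\<^sup>+y. ennreal (wb x y) \<partial>\<nu>' \<partial>\<nu>) \<le> ennreal (2 * \<eta>)"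
          using wb far close by (elim order_trans) (simp add: ennreal_leI)
        have step: "Kc X Y c \<mu> \<nu>' + moment \<nu> \<le> (\<integral>\<^sup>+ z. ennreal (c (fst z) (snd z)) \<partial>\<pi>) + (moment \<nu>' + ennreal e)"
          if \<pi>: "\<pi> \<in> couplings X Y \<mu> \<nu>" for \<pi>
        proof -
          note \<pi>P = couplingsD(1)[OF \<pi>]
          interpret \<pi>: prob_space \<pi> using ProbD(1)[OF \<pi>P] .
          have mw: "(\<lambda>(y, y'). ennreal (wg y y' + wb y y')) \<in> borel_measurable (\<nu> \<Otimes>\<^sub>M \<nu>')"
            using wm unfolding case_prod_unfold by measurable
          show ?thesis
          proof (rule reroute_coupling[OF \<pi> \<nu>'P mw w1 w2])
            fix \<pi>'
            assume \<pi>': "\<pi>' \<in> couplings X Y \<mu> \<nu>'"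
              and R1: "\<And>f. f \<in> borel_measurable \<pi> \<Longrightarrow> (\<integral>\<^sup>+p. ennreal (wg (snd (fst p)) (snd p) + wb (snd (fst p)) (snd p)) * f (fst p) \<partial>(\<pi> \<Otimes>\<^sub>M \<nu>')) = (\<integral>\<^sup>+z. f z \<partial>\<pi>)"
              and R2: "\<And>f. f \<in> borel_measurable \<nu>' \<Longrightarrow> (\<integral>\<^sup>+p. ennreal (wg (snd (fst p)) (snd p) + wb (snd (fst p)) (snd p)) * f (snd p) \<partial>(\<pi> \<Otimes>\<^sub>M \<nu>')) = (\<integral>\<^sup>+y'. f y' \<partial>\<nu>')"
              and R3: "\<And>f. f \<in> borel_measurable (restrict_space borel (X \<times> Y)) \<Longrightarrow>
                 (\<integral>\<^sup>+p. ennreal (wg (snd (fst p)) (snd p) + wb (snd (fst p)) (snd p)) * f (fst (fst p), snd p) \<partial>(\<pi> \<Otimes>\<^sub>M \<nu>')) = (\<integral>\<^sup>+z. f z \<partial>\<pi>')"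
            have [measurable]: "fst \<in> \<pi> \<rightarrow>\<^sub>M \<mu>" "snd \<in> \<pi> \<rightarrow>\<^sub>M \<nu>" using couplingsD[OF \<pi>] by auto
            note [measurable] = cost_measurable(2)[OF \<pi>P] Pcost_YD(3)[OF \<nu>] Pcost_YD(3)[OF \<nu>'] Pcost_XD(3)[OF \<mu>]
              wm[unfolded case_prod_unfold]
            have W [measurable]: "(\<lambda>p. wg (snd (fst p)) (snd p)) \<in> borel_measurable (\<pi> \<Otimes>\<^sub>M \<nu>')"
              and Wb [measurable]: "(\<lambda>p. wb (snd (fst p)) (snd p)) \<in> borel_measurable (\<pi> \<Otimes>\<^sub>M \<nu>')"
              using measurable_compose[of "\<lambda>p. (snd (fst p), snd p)" "\<pi> \<Otimes>\<^sub>M \<nu>'" "\<nu> \<Otimes>\<^sub>M \<nu>'", OF _ wm(1)[unfolded case_prod_unfold]]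
                measurable_compose[of "\<lambda>p. (snd (fst p), snd p)" "\<pi> \<Otimes>\<^sub>M \<nu>'" "\<nu> \<Otimes>\<^sub>M \<nu>'", OF _ wm(2)[unfolded case_prod_unfold]]
              by simp_all
            have sets\<pi>\<nu>': "sets (\<pi> \<Otimes>\<^sub>M \<nu>') = sets ((restrict_space borel X \<Otimes>\<^sub>M restrict_space borel Y) \<Otimes>\<^sub>M restrict_space borel Y)"
              by (intro sets_pair_measure_cong) (simp_all add: ProbD(3)[OF \<pi>P] ProbD(3)[OF \<nu>'P] sets_restrict_borel_Times)
            have map: "(\<lambda>p. (fst (fst p), snd p)) \<in> (\<pi> \<Otimes>\<^sub>M \<nu>') \<rightarrow>\<^sub>M restrict_space borel (X \<times> Y)"
              by (simp add: measurable_cong_sets[OF sets\<pi>\<nu>' sets_restrict_borel_Times])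
            have cm [measurable]: "(\<lambda>p. c (fst (fst p)) (snd p)) \<in> borel_measurable (\<pi> \<Otimes>\<^sub>M \<nu>')"
              using measurable_compose[OF map cost_measurable(1)] by simp
            define T where "T x = (if M < c x y0 then c x y0 else 0)" for x
            have [measurable]: "T \<in> borel_measurable \<mu>" unfolding T_def by measurable
            define f1 where "f1 z = c (fst z) (snd z) + \<epsilon> + \<epsilon> * c x0 (snd z) + 2 * B * T (fst z)" for z
            define f2 where "f2 y = (1 + \<epsilon>) * c x0 y" for y
            have [measurable]: "f1 \<in> borel_measurable \<pi>" "f2 \<in> borel_measurable \<nu>'"
              unfolding f1_def f2_def by measurable
            \<comment> \<open>Three cases. For \<open>c x y0 > M\<close> the tail term in
              \<open>f1\<close> pays for any displacement. Otherwise, if \<open>wg y y'\<close>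
              vanishes, only bad weight is present, and each unit of it pays 2 B M. If it does not
              vanish, y and y' share a piece of the partition and the relative cost changes by at
              most \<epsilon>.\<close>
            have pt: "ennreal (wg y y' + wb y y') * ennreal (c x y') + ennreal (wg y y' + wb y y') * ennreal (c x0 y)
                \<le> ennreal (wg y y' + wb y y') * ennreal (f1 (x, y)) + ennreal (wg y y' + wb y y') * ennreal (f2 y')
                  + ennreal (2 * B * M) * ennreal (wb y y')" (is "?L \<le> ?R")
              if x: "x \<in> X" and y: "y \<in> Y" and y': "y' \<in> Y" for x y y'
            proof -
              note nn = c_nonneg[OF x y] c_nonneg[OF x y'] c_nonneg[OF basic(3) y] c_nonneg[OF basic(3) y']
                c_nonneg[OF x basic(4)] wg0[OF y y'] wb0[OF y y']
              have f0: "f1 (x, y) \<ge> 0" "f2 y' \<ge> 0"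
                using nn \<epsilon> B by (auto simp: f1_def f2_def T_def intro!: add_nonneg_nonneg)
              have n1: "c x y' - c x0 y' - (c x y - c x0 y) \<le> \<epsilon> * c x0 y + \<epsilon> * c x0 y' + 2 * B * c x y0"
                using near[OF x y] near[OF x y'] by (simp add: abs_le_iff)
              have pos: "0 \<le> \<epsilon> * c x0 y" "0 \<le> \<epsilon> * c x0 y'" using nn \<epsilon> by simp_all
              have "(wg y y' + wb y y') * (c x y' + c x0 y - f1 (x, y) - f2 y') \<le> 2 * B * M * wb y y'"
              proof (cases "M < c x y0")
                case True
                then have "c x y' + c x0 y - f1 (x, y) - f2 y' \<le> 0"
                  using n1 \<epsilon> by (simp add: f1_def f2_def T_def algebra_simps)
                then have "(wg y y' + wb y y') * (c x y' + c x0 y - f1 (x, y) - f2 y') \<le> 0"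
                  using nn by (intro mult_nonneg_nonpos) auto
                also have "0 \<le> 2 * B * M * wb y y'" using B M nn by simp
                finally show ?thesis .
              next
                case False
                show ?thesis
                proof (cases "wg y y' = 0")
                  case True
                  have "2 * B * c x y0 \<le> 2 * B * M" using False B by simp
                  then have "c x y' + c x0 y - f1 (x, y) - f2 y' \<le> 2 * B * M"
                    using n1 \<epsilon> False by (simp add: f1_def f2_def T_def algebra_simps)
                  from mult_left_mono[OF this nn(7)] show ?thesis
                    using True by (simp add: ac_simps)
                next
                  case nz: False
                  then obtain k where "k \<in> J - {None}" "\<phi> k y \<noteq> 0" "\<phi> k y' \<noteq> 0" using wg by blast
                  from \<phi>h[OF this(1) _ y y' this(2,3), of x] x False
                  have "\<bar>(c x y - c x0 y) - (c x y' - c x0 y')\<bar> \<le> \<epsilon>" by auto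
                  then have "c x y' + c x0 y - f1 (x, y) - f2 y' \<le> 0"
                    using pos False by (simp add: f1_def f2_def T_def algebra_simps)
                  then have "(wg y y' + wb y y') * (c x y' + c x0 y - f1 (x, y) - f2 y') \<le> 0"
                    using nn by (intro mult_nonneg_nonpos) auto
                  also have "0 \<le> 2 * B * M * wb y y'" using B M nn by simp
                  finally show ?thesis .
                qed
              qed
              then have "(wg y y' + wb y y') * c x y' + (wg y y' + wb y y') * c x0 y
                 \<le> (wg y y' + wb y y') * f1 (x, y) + (wg y y' + wb y y') * f2 y' + 2 * B * M * wb y y'"
                by (simp add: algebra_simps)
              then show ?thesis
                using nn f0 B M by (simp add: ennreal_mult[symmetric] ennreal_plus[symmetric] ennreal_leI del: ennreal_plus)
            qed
            have Ibad: "(\<integral>\<^sup>+p. ennreal (wb (snd (fst p)) (snd p)) \<partial>(\<pi> \<Otimes>\<^sub>M \<nu>')) \<le> ennreal (2 * \<eta>)"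
            proof -
              have "(\<integral>\<^sup>+p. ennreal (wb (snd (fst p)) (snd p)) \<partial>(\<pi> \<Otimes>\<^sub>M \<nu>')) = (\<integral>\<^sup>+z. \<integral>\<^sup>+y'. ennreal (wb (snd z) y') \<partial>\<nu>' \<partial>\<pi>)"
                by (subst \<nu>'.nn_integral_fst[symmetric]) simp_all
              also have "\<dots> = (\<integral>\<^sup>+y. \<integral>\<^sup>+y'. ennreal (wb y y') \<partial>\<nu>' \<partial>\<nu>)"
                by (rule nn_integral_coupling(2)[OF \<pi>, of "\<lambda>y. \<integral>\<^sup>+y'. ennreal (wb y y') \<partial>\<nu>'"])
                   (rule \<nu>'.borel_measurable_nn_integral, simp add: case_prod_unfold)
              finally show ?thesis using bad by simp
            qed
            have If1: "(\<integral>\<^sup>+z. ennreal (f1 z) \<partial>\<pi>) \<le> (\<integral>\<^sup>+ z. ennreal (c (fst z) (snd z)) \<partial>\<pi>) + ennreal \<epsilon> + ennreal \<epsilon> * moment \<nu> + ennreal (e / 4)"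
            proof -
            have split: "ennreal (u + \<epsilon> + \<epsilon> * v + 2 * B * t) = ennreal u + ennreal \<epsilon> + ennreal \<epsilon> * ennreal v + ennreal (2 * B) * ennreal t"
              if "0 \<le> u" "0 \<le> v" "0 \<le> t" for u v t
              using that \<epsilon> B by (simp add: ennreal_mult)
              have "(\<integral>\<^sup>+z. ennreal (f1 z) \<partial>\<pi>) = (\<integral>\<^sup>+z. ennreal (c (fst z) (snd z)) + ennreal \<epsilon> + ennreal \<epsilon> * ennreal (c x0 (snd z)) + ennreal (2 * B) * ennreal (T (fst z)) \<partial>\<pi>)"
              proof (rule nn_integral_cong)
                fix z assume "z \<in> space \<pi>"
                then have z: "fst z \<in> X" "snd z \<in> Y" unfolding ProbD(2)[OF \<pi>P] mem_Times_iff by blast+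
                note nn = c_nonneg[OF z] c_nonneg[OF basic(3) z(2)] c_nonneg[OF z(1) basic(4)]
                have T: "T (fst z) \<ge> 0" using nn(3) by (simp add: T_def)
                show "ennreal (f1 z) = ennreal (c (fst z) (snd z)) + ennreal \<epsilon> + ennreal \<epsilon> * ennreal (c x0 (snd z)) + ennreal (2 * B) * ennreal (T (fst z))"
                  unfolding f1_def by (rule split[OF nn(1,2) T])
              qed
              also have "\<dots> = (\<integral>\<^sup>+ z. ennreal (c (fst z) (snd z)) \<partial>\<pi>) + ennreal \<epsilon> + ennreal \<epsilon> * (\<integral>\<^sup>+ z. ennreal (c x0 (snd z)) \<partial>\<pi>) + ennreal (2 * B) * (\<integral>\<^sup>+ z. ennreal (T (fst z)) \<partial>\<pi>)"
                by (simp add: nn_integral_add nn_integral_cmult \<pi>.emeasure_space_1)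
              also have "(\<integral>\<^sup>+ z. ennreal (c x0 (snd z)) \<partial>\<pi>) = moment \<nu>"
                by (rule nn_integral_coupling(2)[OF \<pi>]) measurable
              also have "(\<integral>\<^sup>+ z. ennreal (T (fst z)) \<partial>\<pi>) = (\<integral>\<^sup>+ x. ennreal (T x) \<partial>\<mu>)"
                by (rule nn_integral_coupling(1)[OF \<pi>, of "\<lambda>x. ennreal (T x)"]) measurable
              also have "ennreal (2 * B) * (\<integral>\<^sup>+ x. ennreal (T x) \<partial>\<mu>) \<le> ennreal (2 * B) * ennreal (e / (8 * B))"
                using tail by (intro mult_left_mono) (simp_all add: T_def)
              also have "\<dots> = ennreal (e / 4)" using B e by (simp add: ennreal_mult[symmetric])
              finally show ?thesis by simp
            qed
            have If2: "(\<integral>\<^sup>+y. ennreal (f2 y) \<partial>\<nu>') = moment \<nu>' + ennreal \<epsilon> * moment \<nu>'"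
            proof -
              have "(\<integral>\<^sup>+y. ennreal (f2 y) \<partial>\<nu>') = (\<integral>\<^sup>+y. ennreal (1 + \<epsilon>) * ennreal (c x0 y) \<partial>\<nu>')"
                using c_nonneg[OF basic(3)] \<epsilon> by (intro nn_integral_cong) (simp add: f2_def ennreal_mult)
              also have "\<dots> = ennreal (1 + \<epsilon>) * moment \<nu>'" by (rule nn_integral_cmult) measurable
              also have "ennreal (1 + \<epsilon>) = 1 + ennreal \<epsilon>" using \<epsilon> by simp
              finally show ?thesis by (simp add: distrib_right)
            qed
            have "Kc X Y c \<mu> \<nu>' + moment \<nu> \<le> (\<integral>\<^sup>+ z. ennreal (c (fst z) (snd z)) \<partial>\<pi>') + moment \<nu>"
              unfolding Kc_def by (intro add_right_mono INF_lower \<pi>')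
            also have "\<dots> = (\<integral>\<^sup>+p. ennreal (wg (snd (fst p)) (snd p) + wb (snd (fst p)) (snd p)) * ennreal (c (fst (fst p)) (snd p)) \<partial>(\<pi> \<Otimes>\<^sub>M \<nu>'))
               + (\<integral>\<^sup>+p. ennreal (wg (snd (fst p)) (snd p) + wb (snd (fst p)) (snd p)) * ennreal (c x0 (snd (fst p))) \<partial>(\<pi> \<Otimes>\<^sub>M \<nu>'))"
            proof -
              have "(\<lambda>z. ennreal (c (fst z) (snd z))) \<in> borel_measurable (restrict_space borel (X \<times> Y))"
                using cost_measurable(1) by simp
              note a = R3[OF this]
              have "(\<integral>\<^sup>+z. ennreal (c x0 (snd z)) \<partial>\<pi>) = moment \<nu>"
                by (rule nn_integral_coupling(2)[OF \<pi>]) measurable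
              moreover have "(\<lambda>z. ennreal (c x0 (snd z))) \<in> borel_measurable \<pi>" by measurable
              note R1[OF this]
              ultimately show ?thesis using a by simp
            qed
            also have "\<dots> = (\<integral>\<^sup>+p. ennreal (wg (snd (fst p)) (snd p) + wb (snd (fst p)) (snd p)) * ennreal (c (fst (fst p)) (snd p))
               + ennreal (wg (snd (fst p)) (snd p) + wb (snd (fst p)) (snd p)) * ennreal (c x0 (snd (fst p))) \<partial>(\<pi> \<Otimes>\<^sub>M \<nu>'))"
              by (rule nn_integral_add[symmetric]) measurable
            also have "\<dots> \<le> (\<integral>\<^sup>+p. ennreal (wg (snd (fst p)) (snd p) + wb (snd (fst p)) (snd p)) * ennreal (f1 (fst p))
                + ennreal (wg (snd (fst p)) (snd p) + wb (snd (fst p)) (snd p)) * ennreal (f2 (snd p))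
                + ennreal (2 * B * M) * ennreal (wb (snd (fst p)) (snd p)) \<partial>(\<pi> \<Otimes>\<^sub>M \<nu>'))"
            proof (rule nn_integral_mono)
              fix p assume "p \<in> space (\<pi> \<Otimes>\<^sub>M \<nu>')"
              then have "fst (fst p) \<in> X" "snd (fst p) \<in> Y" "snd p \<in> Y"
                unfolding space_pair_measure sp ProbD(2)[OF \<pi>P] mem_Times_iff by blast+
              from pt[OF this] show "ennreal (wg (snd (fst p)) (snd p) + wb (snd (fst p)) (snd p)) * ennreal (c (fst (fst p)) (snd p))
               + ennreal (wg (snd (fst p)) (snd p) + wb (snd (fst p)) (snd p)) * ennreal (c x0 (snd (fst p)))
                \<le> ennreal (wg (snd (fst p)) (snd p) + wb (snd (fst p)) (snd p)) * ennreal (f1 (fst p))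
                + ennreal (wg (snd (fst p)) (snd p) + wb (snd (fst p)) (snd p)) * ennreal (f2 (snd p))
                + ennreal (2 * B * M) * ennreal (wb (snd (fst p)) (snd p))" by simp
            qed
            also have "\<dots> = (\<integral>\<^sup>+z. ennreal (f1 z) \<partial>\<pi>) + (\<integral>\<^sup>+y. ennreal (f2 y) \<partial>\<nu>')
                + ennreal (2 * B * M) * (\<integral>\<^sup>+p. ennreal (wb (snd (fst p)) (snd p)) \<partial>(\<pi> \<Otimes>\<^sub>M \<nu>'))"
              using R1[of "\<lambda>z. ennreal (f1 z)"] R2[of "\<lambda>y. ennreal (f2 y)"] by (simp add: nn_integral_add nn_integral_cmult)
            also have "\<dots> \<le> ((\<integral>\<^sup>+ z. ennreal (c (fst z) (snd z)) \<partial>\<pi>) + ennreal \<epsilon> + ennreal \<epsilon> * ennreal C + ennreal (e / 4))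
                + (moment \<nu>' + ennreal \<epsilon> * ennreal C) + ennreal (2 * B * M) * ennreal (2 * \<eta>)"
              unfolding If2
              by (intro add_mono mult_left_mono Ibad order_trans[OF If1] mC order_refl) simp_all
            also have "\<dots> = (\<integral>\<^sup>+ z. ennreal (c (fst z) (snd z)) \<partial>\<pi>) + (moment \<nu>' + (ennreal \<epsilon> + ennreal \<epsilon> * ennreal C + ennreal (e / 4) + ennreal \<epsilon> * ennreal C + ennreal (2 * B * M) * ennreal (2 * \<eta>)))"
              by (simp add: ac_simps)
            also have "ennreal \<epsilon> + ennreal \<epsilon> * ennreal C + ennreal (e / 4) + ennreal \<epsilon> * ennreal C + ennreal (2 * B * M) * ennreal (2 * \<eta>)
                = ennreal (\<epsilon> + \<epsilon> * C + e / 4 + \<epsilon> * C + 2 * B * M * (2 * \<eta>))"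
              using \<epsilon> C e B M \<eta> by (simp add: ennreal_mult[symmetric] ennreal_plus[symmetric] del: ennreal_plus)
            also have "\<epsilon> + \<epsilon> * C + e / 4 + \<epsilon> * C + 2 * B * M * (2 * \<eta>) = e"
            proof -
              have "\<epsilon> * (1 + 2 * C) = e / 2" using C by (simp add: \<epsilon>_def field_simps)
              moreover have "2 * B * M * (2 * \<eta>) = e / 4" using B M by (simp add: \<eta>_def)
              ultimately show ?thesis by (simp add: algebra_simps)
            qed
            finally show "Kc X Y c \<mu> \<nu>' + moment \<nu> \<le> (\<integral>\<^sup>+ z. ennreal (c (fst z) (snd z)) \<partial>\<pi>) + (moment \<nu>' + ennreal e)" .
          qed
        qed
        have fin: "moment \<nu>' + ennreal e < \<infinity>" using Pcost_YD(2)[OF \<nu>'] by (simp add: less_top)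
        \<comment> \<open>With the finite term subtracted, \<open>step\<close> becomes a lower bound
          for every coupling and so for the infimum.\<close>
        have "(Kc X Y c \<mu> \<nu>' + moment \<nu>) - (moment \<nu>' + ennreal e) \<le> Kc X Y c \<mu> \<nu>"
          unfolding Kc_def[of X Y c \<mu> \<nu>]
        proof (rule INF_greatest)
          fix \<pi> assume "\<pi> \<in> couplings X Y \<mu> \<nu>"
          from step[OF this] fin
          show "Kc X Y c \<mu> \<nu>' + moment \<nu> - (moment \<nu>' + ennreal e) \<le> (\<integral>\<^sup>+ z. ennreal (c (fst z) (snd z)) \<partial>\<pi>)"
            by (auto simp: ennreal_minus_le_iff add.commute)
        qed
        then show "Kc X Y c \<mu> \<nu>' + moment \<nu> \<le> Kc X Y c \<mu> \<nu> + moment \<nu>' + ennreal e"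
          using fin by (auto simp: ennreal_minus_le_iff ac_simps)
      qed
    qed
  qed
qed

end

section \<open>The barycenter functional\<close>

lemma product_coupling:
  fixes \<mu> \<nu> :: "'a::euclidean_space measure"
  assumes \<mu>: "\<mu> \<in> Prob X" and \<nu>: "\<nu> \<in> Prob Y"
  shows "\<mu> \<Otimes>\<^sub>M \<nu> \<in> couplings X Y \<mu> \<nu>"
proof -
  interpret \<mu>: prob_space \<mu> using ProbD(1)[OF \<mu>] .
  interpret \<nu>: prob_space \<nu> using ProbD(1)[OF \<nu>] .
  interpret pair_prob_space \<mu> \<nu> ..
  have s: "sets (\<mu> \<Otimes>\<^sub>M \<nu>) = sets (restrict_space borel (X \<times> Y))"
    unfolding sets_restrict_borel_Times using ProbD(3)[OF \<mu>] ProbD(3)[OF \<nu>] by (rule sets_pair_measure_cong)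
  have "\<mu> \<Otimes>\<^sub>M \<nu> \<in> Prob (X \<times> Y)"
    using s prob_space_axioms by (simp add: Prob_def space_pair_measure ProbD(2)[OF \<mu>] ProbD(2)[OF \<nu>])
  moreover have "distr (\<mu> \<Otimes>\<^sub>M \<nu>) \<mu> fst = \<mu>"
  proof (rule measure_eqI)
    fix A assume "A \<in> sets (distr (\<mu> \<Otimes>\<^sub>M \<nu>) \<mu> fst)"
    then have A: "A \<in> sets \<mu>" by simp
    then have "fst -` A \<inter> space (\<mu> \<Otimes>\<^sub>M \<nu>) = A \<times> space \<nu>"
      using sets.sets_into_space by (fastforce simp: space_pair_measure)
    then show "emeasure (distr (\<mu> \<Otimes>\<^sub>M \<nu>) \<mu> fst) A = emeasure \<mu> A"
      using A by (simp add: emeasure_distr \<nu>.emeasure_pair_measure_Times \<nu>.emeasure_space_1)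
  qed simp
  moreover have "distr (\<mu> \<Otimes>\<^sub>M \<nu>) \<nu> snd = \<nu>"
  proof (rule measure_eqI)
    fix A assume "A \<in> sets (distr (\<mu> \<Otimes>\<^sub>M \<nu>) \<nu> snd)"
    then have A: "A \<in> sets \<nu>" by simp
    then have "snd -` A \<inter> space (\<mu> \<Otimes>\<^sub>M \<nu>) = space \<mu> \<times> A"
      using sets.sets_into_space by (fastforce simp: space_pair_measure)
    then show "emeasure (distr (\<mu> \<Otimes>\<^sub>M \<nu>) \<nu> snd) A = emeasure \<nu> A"
      using A by (simp add: emeasure_distr \<nu>.emeasure_pair_measure_Times \<mu>.emeasure_space_1)
  qed simp
  moreover have "distr (\<mu> \<Otimes>\<^sub>M \<nu>) (restrict_space borel X) fst = distr (\<mu> \<Otimes>\<^sub>M \<nu>) \<mu> fst"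
    "distr (\<mu> \<Otimes>\<^sub>M \<nu>) (restrict_space borel Y) snd = distr (\<mu> \<Otimes>\<^sub>M \<nu>) \<nu> snd"
    using ProbD(3)[OF \<mu>] ProbD(3)[OF \<nu>] by (auto intro!: distr_cong)
  ultimately show ?thesis
    by (simp add: couplings_def)
qed

lemma return_Prob:
  assumes "y \<in> S"
  shows "return (restrict_space borel S) y \<in> Prob S"
  using assms by (auto simp: Prob_def space_restrict_space intro!: prob_space_return)

section \<open>Comparison of cost and moment; coercivity and semicontinuity of the
  functional\<close>

context transport_cost begin

abbreviation rmoment :: "'a measure \<Rightarrow> real" where
  "rmoment \<nu> \<equiv> enn2real (moment \<nu>)"

abbreviation rKc :: "'a measure \<Rightarrow> 'a measure \<Rightarrow> real" where
  "rKc \<mu> \<nu> \<equiv> enn2real (Kc X Y c \<mu> \<nu>)"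

lemma moment_real: "\<nu> \<in> Pcost_Y Y c x0 \<Longrightarrow> ennreal (rmoment \<nu>) = moment \<nu>"
  using Pcost_YD(2) by (simp add: less_top)

text \<open>The bounds of (A3) split into a function of x and a function of y, so their integrals
  under a coupling see only the marginals. Every coupling therefore yields the lower bound, and a
  single one, the product, suffices for the upper.\<close>

lemma Kc_bounds:
  assumes \<mu>: "\<mu> \<in> Pcost_X X c y0" and \<nu>: "\<nu> \<in> Pcost_Y Y c x0" and \<epsilon>: "0 < \<epsilon>" "\<epsilon> < 1" and B: "B > 0"
    and near: "\<And>x y. x \<in> X \<Longrightarrow> y \<in> Y \<Longrightarrow> \<bar>c x y - c x0 y\<bar> \<le> \<epsilon> * c x0 y + B * c x y0"
  shows "Kc X Y c \<mu> \<nu> \<le> ennreal (1 + \<epsilon>) * moment \<nu> + ennreal B * (\<integral>\<^sup>+ x. ennreal (c x y0) \<partial>\<mu>)"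
    and "ennreal (1 - \<epsilon>) * moment \<nu> \<le> Kc X Y c \<mu> \<nu> + ennreal B * (\<integral>\<^sup>+ x. ennreal (c x y0) \<partial>\<mu>)"
proof -
  let ?I = "\<integral>\<^sup>+ x. ennreal (c x y0) \<partial>\<mu>"
  have lin: "(\<integral>\<^sup>+z. ennreal a * ennreal (c x0 (snd z)) \<partial>\<pi>) = ennreal a * moment \<nu>"
    "(\<integral>\<^sup>+z. ennreal a * ennreal (c (fst z) y0) \<partial>\<pi>) = ennreal a * ?I"
    and meas: "(\<lambda>z. c x0 (snd z)) \<in> borel_measurable \<pi>" "(\<lambda>z. c (fst z) y0) \<in> borel_measurable \<pi>"
    if \<pi>: "\<pi> \<in> couplings X Y \<mu> \<nu>" for \<pi> a
  proof -
    note [measurable] = Pcost_YD(3)[OF \<nu>] Pcost_XD(3)[OF \<mu>] couplingsD(4,5)[OF \<pi>]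
    show m: "(\<lambda>z. c x0 (snd z)) \<in> borel_measurable \<pi>" "(\<lambda>z. c (fst z) y0) \<in> borel_measurable \<pi>"
      using measurable_compose[OF couplingsD(4)[OF \<pi>] Pcost_XD(3)[OF \<mu>]]
        measurable_compose[OF couplingsD(5)[OF \<pi>] Pcost_YD(3)[OF \<nu>]] by auto
    show "(\<integral>\<^sup>+z. ennreal a * ennreal (c x0 (snd z)) \<partial>\<pi>) = ennreal a * moment \<nu>"
      using m nn_integral_coupling(2)[OF \<pi>, of "\<lambda>y. ennreal (c x0 y)"] by (simp add: nn_integral_cmult)
    show "(\<integral>\<^sup>+z. ennreal a * ennreal (c (fst z) y0) \<partial>\<pi>) = ennreal a * ?I"
      using m nn_integral_coupling(1)[OF \<pi>, of "\<lambda>x. ennreal (c x y0)"] by (simp add: nn_integral_cmult)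
  qed
  have pt: "ennreal (c x y) \<le> ennreal (1 + \<epsilon>) * ennreal (c x0 y) + ennreal B * ennreal (c x y0)"
    "ennreal (1 - \<epsilon>) * ennreal (c x0 y) \<le> ennreal (c x y) + ennreal B * ennreal (c x y0)"
    if "x \<in> X" "y \<in> Y" for x y
    using near[OF that] c_nonneg[OF that] c_nonneg[OF basic(3) that(2)] c_nonneg[OF that(1) basic(4)] \<epsilon> B
    by (auto simp: ennreal_mult[symmetric] ennreal_plus[symmetric] abs_le_iff algebra_simps
        simp del: ennreal_plus intro!: ennreal_leI)
  let ?\<pi> = "\<mu> \<Otimes>\<^sub>M \<nu>"
  have \<pi>: "?\<pi> \<in> couplings X Y \<mu> \<nu>" by (rule product_coupling[OF Pcost_XD(1)[OF \<mu>] Pcost_YD(1)[OF \<nu>]])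
  have "Kc X Y c \<mu> \<nu> \<le> (\<integral>\<^sup>+z. ennreal (c (fst z) (snd z)) \<partial>?\<pi>)"
    unfolding Kc_def by (rule INF_lower[OF \<pi>])
  also have "\<dots> \<le> (\<integral>\<^sup>+z. ennreal (1 + \<epsilon>) * ennreal (c x0 (snd z)) + ennreal B * ennreal (c (fst z) y0) \<partial>?\<pi>)"
    using pt(1) ProbD(2)[OF couplingsD(1)[OF \<pi>]] by (intro nn_integral_mono) auto
  also have "\<dots> = ennreal (1 + \<epsilon>) * moment \<nu> + ennreal B * ?I"
    using meas[OF \<pi>] by (subst nn_integral_add) (auto simp: lin[OF \<pi>] simp del: ennreal_plus)
  finally show "Kc X Y c \<mu> \<nu> \<le> ennreal (1 + \<epsilon>) * moment \<nu> + ennreal B * ?I" .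
  have fin: "ennreal B * ?I < \<infinity>" using Pcost_XD(2)[OF \<mu>] by (simp add: ennreal_mult_less_top)
  have "ennreal (1 - \<epsilon>) * moment \<nu> - ennreal B * ?I \<le> Kc X Y c \<mu> \<nu>"
    unfolding Kc_def
  proof (rule INF_greatest)
    fix \<pi> assume \<pi>: "\<pi> \<in> couplings X Y \<mu> \<nu>"
    have "ennreal (1 - \<epsilon>) * moment \<nu> = (\<integral>\<^sup>+z. ennreal (1 - \<epsilon>) * ennreal (c x0 (snd z)) \<partial>\<pi>)"
      by (rule lin(1)[OF \<pi>, symmetric])
    also have "\<dots> \<le> (\<integral>\<^sup>+z. ennreal (c (fst z) (snd z)) + ennreal B * ennreal (c (fst z) y0) \<partial>\<pi>)"
      using pt(2) ProbD(2)[OF couplingsD(1)[OF \<pi>]] by (intro nn_integral_mono) auto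
    also have "\<dots> = (\<integral>\<^sup>+z. ennreal (c (fst z) (snd z)) \<partial>\<pi>) + ennreal B * ?I"
      using meas[OF \<pi>] cost_measurable(2)[OF couplingsD(1)[OF \<pi>]]
      by (subst nn_integral_add) (auto simp: lin[OF \<pi>])
    finally show "ennreal (1 - \<epsilon>) * moment \<nu> - ennreal B * ?I \<le> (\<integral>\<^sup>+z. ennreal (c (fst z) (snd z)) \<partial>\<pi>)"
      using fin by (auto simp: ennreal_minus_le_iff add.commute)
  qed
  then show "ennreal (1 - \<epsilon>) * moment \<nu> \<le> Kc X Y c \<mu> \<nu> + ennreal B * ?I"
    using fin by (auto simp: ennreal_minus_le_iff add.commute)
qed

text \<open>\<open>B\<close> stems from (A3) and \<epsilon> alone, hence serves all \<mu> and \<nu>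
  at once. The last conjunct makes the conversion to reals lossless.\<close>

lemma Kc_near_moment:
  assumes \<epsilon>: "0 < \<epsilon>" "\<epsilon> < 1"
  shows "\<exists>B>0. \<forall>\<mu>\<in>Pcost_X X c y0. \<forall>\<nu>\<in>Pcost_Y Y c x0.
    \<bar>rKc \<mu> \<nu> - rmoment \<nu>\<bar> \<le> \<epsilon> * rmoment \<nu> + B * enn2real (\<integral>\<^sup>+ x. ennreal (c x y0) \<partial>\<mu>)
      \<and> ennreal (rKc \<mu> \<nu>) = Kc X Y c \<mu> \<nu>"
proof -
  obtain B where B: "B > 0" and near: "\<And>x y. x \<in> X \<Longrightarrow> y \<in> Y \<Longrightarrow> \<bar>c x y - c x0 y\<bar> \<le> \<epsilon> * c x0 y + B * c x y0"
    using cost_near_reference[OF \<epsilon>(1)] by blast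
  have *: "\<bar>rKc \<mu> \<nu> - rmoment \<nu>\<bar> \<le> \<epsilon> * rmoment \<nu> + B * enn2real (\<integral>\<^sup>+ x. ennreal (c x y0) \<partial>\<mu>)
      \<and> ennreal (rKc \<mu> \<nu>) = Kc X Y c \<mu> \<nu>"
    if \<mu>: "\<mu> \<in> Pcost_X X c y0" and \<nu>: "\<nu> \<in> Pcost_Y Y c x0" for \<mu> \<nu>
  proof -
    define i where "i = enn2real (\<integral>\<^sup>+ x. ennreal (c x y0) \<partial>\<mu>)"
    have i: "(\<integral>\<^sup>+ x. ennreal (c x y0) \<partial>\<mu>) = ennreal i" "i \<ge> 0"
      using Pcost_XD(2)[OF \<mu>] by (simp_all add: i_def less_top)
    define j where "j = rmoment \<nu>"
    have j: "moment \<nu> = ennreal j" "j \<ge> 0"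
      using moment_real[OF \<nu>] by (simp_all add: j_def)
    have up: "Kc X Y c \<mu> \<nu> \<le> ennreal ((1 + \<epsilon>) * j + B * i)"
      and lo: "ennreal ((1 - \<epsilon>) * j) \<le> Kc X Y c \<mu> \<nu> + ennreal (B * i)"
      using Kc_bounds[OF \<mu> \<nu> \<epsilon> B near] \<epsilon> B i j
      by (simp_all add: ennreal_mult[symmetric] ennreal_plus[symmetric] del: ennreal_plus)
    have fin: "Kc X Y c \<mu> \<nu> < \<top>" using up le_less_trans ennreal_less_top by blast
    define k where "k = rKc \<mu> \<nu>"
    have k: "Kc X Y c \<mu> \<nu> = ennreal k" "k \<ge> 0" using fin by (simp_all add: k_def)
    have "k \<le> (1 + \<epsilon>) * j + B * i" "(1 - \<epsilon>) * j \<le> k + B * i"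
      using up lo i j \<epsilon> B unfolding k(1)
      by (simp_all add: k(2) ennreal_plus[symmetric] ennreal_le_iff del: ennreal_plus)
    then show ?thesis
      using k(1) unfolding k_def[symmetric] j_def[symmetric] i_def[symmetric] by (auto simp: abs_le_iff algebra_simps)
  qed
  show ?thesis using B * by blast
qed

lemma Kc_real: "\<mu> \<in> Pcost_X X c y0 \<Longrightarrow> \<nu> \<in> Pcost_Y Y c x0 \<Longrightarrow> ennreal (rKc \<mu> \<nu>) = Kc X Y c \<mu> \<nu>"
  using Kc_near_moment[of "1/2"] by auto

text \<open>Replacing every cost by the moment turns the functional into the moment itself, because
  the weights sum to 1. The error is at most the sum of \<open>\<bar>a i\<bar>\<close> times
  \<epsilon> \<open>rmoment \<nu>\<close> + B \<open>I i\<close>, and a small \<epsilon> lets half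
  of the moment survive.\<close>

lemma barycenter_coercive:
  assumes a: "(\<Sum>i<m. a i) = 1" and \<mu>: "\<forall>i<m. \<mu> i \<in> Pcost_X X c y0"
  obtains D where "\<And>\<nu>. \<nu> \<in> Pcost_Y Y c x0 \<Longrightarrow> rmoment \<nu> / 2 \<le> barycenter_fun X Y c m a \<mu> \<nu> + D"
proof -
  define A where "A = (\<Sum>i<m. \<bar>a i\<bar>)"
  have A: "A \<ge> 1" unfolding A_def using sum_abs[of a "{..<m}"] a by simp
  \<comment> \<open>Chosen so that the total error coefficient \<epsilon> A is 1/2. Weights summing
    to 1 force A \<ge> 1, hence \<epsilon> < 1 as \<open>Kc_near_moment\<close> demands.\<close>
  define \<epsilon> where "\<epsilon> = 1 / (2 * A)"
  have \<epsilon>: "0 < \<epsilon>" "\<epsilon> < 1" "\<epsilon> * A = 1/2" using A by (auto simp: \<epsilon>_def)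
  obtain B where near: "\<forall>\<mu>\<in>Pcost_X X c y0. \<forall>\<nu>\<in>Pcost_Y Y c x0.
    \<bar>rKc \<mu> \<nu> - rmoment \<nu>\<bar> \<le> \<epsilon> * rmoment \<nu> + B * enn2real (\<integral>\<^sup>+ x. ennreal (c x y0) \<partial>\<mu>)"
    using Kc_near_moment[OF \<epsilon>(1,2)] by auto
  define I where "I i = enn2real (\<integral>\<^sup>+ x. ennreal (c x y0) \<partial>\<mu> i)" for i
  show thesis
  proof (rule that[of "\<Sum>i<m. \<bar>a i\<bar> * (B * I i)"])
    fix \<nu> assume \<nu>: "\<nu> \<in> Pcost_Y Y c x0"
    have "a i * rmoment \<nu> \<le> a i * rKc (\<mu> i) \<nu> + (\<bar>a i\<bar> * (\<epsilon> * rmoment \<nu>) + \<bar>a i\<bar> * (B * I i))" if "i < m" for i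
    proof -
      have "a i * (rmoment \<nu> - rKc (\<mu> i) \<nu>) \<le> \<bar>a i\<bar> * \<bar>rKc (\<mu> i) \<nu> - rmoment \<nu>\<bar>"
        by (metis abs_ge_self abs_minus_commute abs_mult)
      also have "\<dots> \<le> \<bar>a i\<bar> * (\<epsilon> * rmoment \<nu> + B * I i)"
        using near \<mu>[rule_format, OF that] \<nu> by (intro mult_left_mono) (simp_all add: I_def)
      finally show ?thesis by (simp add: algebra_simps)
    qed
    then have "(\<Sum>i<m. a i * rmoment \<nu>) \<le> (\<Sum>i<m. a i * rKc (\<mu> i) \<nu> + (\<bar>a i\<bar> * (\<epsilon> * rmoment \<nu>) + \<bar>a i\<bar> * (B * I i)))"
      by (intro sum_mono) simp
    then have "rmoment \<nu> \<le> barycenter_fun X Y c m a \<mu> \<nu> + (\<epsilon> * A) * rmoment \<nu> + (\<Sum>i<m. \<bar>a i\<bar> * (B * I i))"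
      unfolding sum.distrib sum_distrib_right[symmetric] a A_def[symmetric]
      by (simp add: barycenter_fun_def ac_simps)
    then show "rmoment \<nu> / 2 \<le> barycenter_fun X Y c m a \<mu> \<nu> + (\<Sum>i<m. \<bar>a i\<bar> * (B * I i))"
      unfolding \<epsilon>(3) by simp
  qed
qed

text \<open>Weak convergence tests bounded functions only, so \<open>c x0\<close> is truncated at
  height k; by monotone convergence some truncation already has an integral above
  \<open>l\<close>.\<close>

lemma moment_lsc:
  assumes \<nu>s: "\<And>n. \<nu>s n \<in> Prob Y" and \<nu>: "\<nu> \<in> Prob Y" and conv: "Defs.weak_conv Y \<nu>s \<nu>"
    and l: "ennreal l < moment \<nu>"
  shows "\<forall>\<^sub>F n in sequentially. ennreal l < moment (\<nu>s n)"
proof -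
  note cY = c_continuous_y[OF basic(3)]
  define f where "f k y = min (c x0 y) (real k)" for k y
  have fc: "continuous_on Y (f k)" for k
    unfolding f_def[abs_def] by (intro continuous_intros cY)
  have f0: "0 \<le> f k y" "f k y \<le> real k" "f k y \<le> c x0 y" if "y \<in> Y" for k y
    using c_nonneg[OF basic(3) that] by (auto simp: f_def)
  have int: "(\<integral>\<^sup>+y. ennreal (f k y) \<partial>M) = ennreal (\<integral>y. f k y \<partial>M)" if M: "M \<in> Prob Y" for M k
  proof -
    interpret M: prob_space M using ProbD(1)[OF M] .
    show ?thesis
      using f0 ProbD(2)[OF M] continuous_on_measurable_Prob[OF M fc]
      by (intro nn_integral_eq_integral M.integrable_const_bound[of _ "real k"]) auto
  qed
  have "moment \<nu> = (\<integral>\<^sup>+y. (SUP k. ennreal (f k y)) \<partial>\<nu>)"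
  proof (rule nn_integral_cong)
    fix y
    obtain N where N: "c x0 y \<le> real N" using real_arch_simple by blast
    show "ennreal (c x0 y) = (SUP k. ennreal (f k y))"
      using N by (intro antisym SUP_least SUP_upper2[of N]) (auto simp: f_def intro!: ennreal_leI)
  qed
  also have "\<dots> = (SUP k. \<integral>\<^sup>+y. ennreal (f k y) \<partial>\<nu>)"
  proof (rule nn_integral_monotone_convergence_SUP)
    show "incseq (\<lambda>k y. ennreal (f k y))"
      by (auto simp: incseq_def le_fun_def f_def intro!: ennreal_leI)
    show "(\<lambda>y. ennreal (f k y)) \<in> borel_measurable \<nu>" for k
      using continuous_on_measurable_Prob[OF \<nu> fc] by simp
  qed
  finally obtain k where "ennreal l < (\<integral>\<^sup>+y. ennreal (f k y) \<partial>\<nu>)"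
    using l by (auto simp: less_SUP_iff)
  then have "ennreal l < ennreal (\<integral>y. f k y \<partial>\<nu>)" by (simp only: int[OF \<nu>])
  moreover have "(\<lambda>n. \<integral>y. f k y \<partial>\<nu>s n) \<longlonglongrightarrow> (\<integral>y. f k y \<partial>\<nu>)"
  proof -
    have "bounded (f k ` Y)" unfolding bounded_iff using f0 by (intro exI[of _ "real k"]) auto
    then show ?thesis using conv fc unfolding Defs.weak_conv_def by blast
  qed
  then have "(\<lambda>n. ennreal (\<integral>y. f k y \<partial>\<nu>s n)) \<longlonglongrightarrow> ennreal (\<integral>y. f k y \<partial>\<nu>)"
    by (rule tendsto_ennrealI)
  ultimately have "\<forall>\<^sub>F n in sequentially. ennreal l < ennreal (\<integral>y. f k y \<partial>\<nu>s n)"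
    by (intro order_tendstoD)
  then show ?thesis
  proof (rule eventually_mono)
    fix n assume "ennreal l < ennreal (\<integral>y. f k y \<partial>\<nu>s n)"
    also have "\<dots> \<le> moment (\<nu>s n)"
      unfolding int[OF \<nu>s, symmetric] using f0 ProbD(2)[OF \<nu>s]
      by (intro nn_integral_mono ennreal_leI) auto
    finally show "ennreal l < moment (\<nu>s n)" .
  qed
qed

lemma weak_limit_Pcost:
  assumes \<nu>s: "\<And>n. \<nu>s n \<in> Pcost_Y Y c x0" and bound: "\<And>n. moment (\<nu>s n) \<le> ennreal C"
    and \<nu>: "\<nu> \<in> Prob Y" and conv: "Defs.weak_conv Y \<nu>s \<nu>"
  shows "\<nu> \<in> Pcost_Y Y c x0" "moment \<nu> \<le> ennreal C"
proof -
  show le: "moment \<nu> \<le> ennreal C"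
  proof (rule ccontr)
    assume "\<not> moment \<nu> \<le> ennreal C"
    then have "\<forall>\<^sub>F n in sequentially. ennreal C < moment (\<nu>s n)"
      using moment_lsc[OF Pcost_YD(1)[OF \<nu>s] \<nu> conv] by simp
    then show False using bound by (simp add: not_less[symmetric])
  qed
  show "\<nu> \<in> Pcost_Y Y c x0"
    using \<nu> le_less_trans[OF le, of \<infinity>] by (simp add: Pcost_Y_def)
qed

text \<open>\<open>transport_cost_stable\<close> is applied in both orders to
  \<open>\<nu>s n\<close> and the limit. The limit is admissible there since it inherits the moment
  bound.\<close>

lemma Kc_minus_moment_weakly_continuous:
  assumes \<mu>: "\<mu> \<in> Pcost_X X c y0"
    and \<nu>s: "\<And>n. \<nu>s n \<in> Pcost_Y Y c x0" and bound: "\<And>n. moment (\<nu>s n) \<le> ennreal C"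
    and \<nu>: "\<nu> \<in> Prob Y" and conv: "Defs.weak_conv Y \<nu>s \<nu>"
  shows "(\<lambda>n. rKc \<mu> (\<nu>s n) - rmoment (\<nu>s n)) \<longlonglongrightarrow> rKc \<mu> \<nu> - rmoment \<nu>"
proof (rule LIMSEQ_I)
  fix r :: real assume r: "0 < r"
  define e where "e = r / 2"
  have e: "e > 0" "e < r" using r by (auto simp: e_def)
  \<comment> \<open>\<open>transport_cost_stable\<close> asks for a positive bound, while
    \<open>C\<close> is an arbitrary real.\<close>
  define C' where "C' = max 1 C"
  have C': "C' > 0" and le: "ennreal C \<le> ennreal C'" by (auto simp: C'_def intro!: ennreal_leI)
  note \<nu>P = weak_limit_Pcost[OF \<nu>s bound \<nu> conv]
  have real_ineq: "rKc \<mu> \<nu>2 + rmoment \<nu>1 \<le> rKc \<mu> \<nu>1 + rmoment \<nu>2 + e"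
    if "\<nu>1 \<in> Pcost_Y Y c x0" "\<nu>2 \<in> Pcost_Y Y c x0"
      and le: "Kc X Y c \<mu> \<nu>2 + moment \<nu>1 \<le> Kc X Y c \<mu> \<nu>1 + moment \<nu>2 + ennreal e" for \<nu>1 \<nu>2
  proof -
    have "ennreal (rKc \<mu> \<nu>2) + ennreal (rmoment \<nu>1) \<le> ennreal (rKc \<mu> \<nu>1) + ennreal (rmoment \<nu>2) + ennreal e"
      using le by (simp only: Kc_real[OF \<mu> that(1)] Kc_real[OF \<mu> that(2)] moment_real[OF that(1)] moment_real[OF that(2)])
    then have "ennreal (rKc \<mu> \<nu>2 + rmoment \<nu>1) \<le> ennreal (rKc \<mu> \<nu>1 + rmoment \<nu>2 + e)"
      using e by (simp add: ennreal_plus)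
    then show ?thesis using e by (subst (asm) ennreal_le_iff) (auto intro!: add_nonneg_nonneg)
  qed
  show "\<exists>N. \<forall>n\<ge>N. norm (rKc \<mu> (\<nu>s n) - rmoment (\<nu>s n) - (rKc \<mu> \<nu> - rmoment \<nu>)) < r"
  proof (rule transport_cost_stable[OF \<mu> e(1) C'])
    fix J :: "'a option set" and \<phi> :: "'a option \<Rightarrow> 'a \<Rightarrow> real" and \<eta> :: real
    assume J: "finite J" and \<phi>: "\<And>k. k \<in> J \<Longrightarrow> continuous_on Y (\<phi> k)" "\<And>k. k \<in> J \<Longrightarrow> bounded (\<phi> k ` Y)"
      and \<eta>: "\<eta> > 0"
      and stable: "\<And>\<nu> \<nu>'. \<nu> \<in> Pcost_Y Y c x0 \<Longrightarrow> \<nu>' \<in> Pcost_Y Y c x0 \<Longrightarrow> moment \<nu> \<le> ennreal C' \<Longrightarrow> moment \<nu>' \<le> ennreal C'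
          \<Longrightarrow> (\<Sum>k\<in>J. \<bar>(\<integral>y. \<phi> k y \<partial>\<nu>) - (\<integral>y. \<phi> k y \<partial>\<nu>')\<bar>) \<le> \<eta>
          \<Longrightarrow> Kc X Y c \<mu> \<nu>' + moment \<nu> \<le> Kc X Y c \<mu> \<nu> + moment \<nu>' + ennreal e"
    have "(\<lambda>n. \<Sum>k\<in>J. \<bar>(\<integral>y. \<phi> k y \<partial>\<nu>s n) - (\<integral>y. \<phi> k y \<partial>\<nu>)\<bar>) \<longlonglongrightarrow> (\<Sum>k\<in>J. \<bar>(\<integral>y. \<phi> k y \<partial>\<nu>) - (\<integral>y. \<phi> k y \<partial>\<nu>)\<bar>)"
      using conv \<phi> unfolding Defs.weak_conv_def by (intro tendsto_sum tendsto_rabs tendsto_diff tendsto_const) blast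
    then have "\<forall>\<^sub>F n in sequentially. (\<Sum>k\<in>J. \<bar>(\<integral>y. \<phi> k y \<partial>\<nu>s n) - (\<integral>y. \<phi> k y \<partial>\<nu>)\<bar>) < \<eta>"
      by (rule order_tendstoD) (use \<eta> in simp)
    then obtain N where N: "\<And>n. n \<ge> N \<Longrightarrow> (\<Sum>k\<in>J. \<bar>(\<integral>y. \<phi> k y \<partial>\<nu>s n) - (\<integral>y. \<phi> k y \<partial>\<nu>)\<bar>) < \<eta>"
      unfolding eventually_sequentially by blast
    show ?thesis
    proof (intro exI allI impI)
      fix n assume "N \<le> n"
      then have close: "(\<Sum>k\<in>J. \<bar>(\<integral>y. \<phi> k y \<partial>\<nu>s n) - (\<integral>y. \<phi> k y \<partial>\<nu>)\<bar>) \<le> \<eta>"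
        using N by (simp add: less_imp_le)
      note b = order_trans[OF bound[of n] le] order_trans[OF \<nu>P(2) le]
      have "rKc \<mu> \<nu> + rmoment (\<nu>s n) \<le> rKc \<mu> (\<nu>s n) + rmoment \<nu> + e"
        by (rule real_ineq[OF \<nu>s \<nu>P(1) stable[OF \<nu>s \<nu>P(1) b close]])
      moreover have "rKc \<mu> (\<nu>s n) + rmoment \<nu> \<le> rKc \<mu> \<nu> + rmoment (\<nu>s n) + e"
        by (rule real_ineq[OF \<nu>P(1) \<nu>s stable[OF \<nu>P(1) \<nu>s b(2,1)]])
           (use close in \<open>simp add: abs_minus_commute\<close>)
      ultimately show "norm (rKc \<mu> (\<nu>s n) - rmoment (\<nu>s n) - (rKc \<mu> \<nu> - rmoment \<nu>)) < r"
        using e by (simp add: abs_less_iff)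
    qed
  qed
qed

text \<open>Signs are harmless in \<open>?G\<close>, where every term converges. Semicontinuity is
  needed only for the moment, whose coefficient is the sum of the weights and therefore
  positive.\<close>

lemma barycenter_lsc:
  assumes a: "(\<Sum>i<m. a i) = 1" and \<mu>: "\<forall>i<m. \<mu> i \<in> Pcost_X X c y0"
    and \<nu>s: "\<And>n. \<nu>s n \<in> Pcost_Y Y c x0" and bound: "\<And>n. moment (\<nu>s n) \<le> ennreal C"
    and \<nu>: "\<nu> \<in> Prob Y" and conv: "Defs.weak_conv Y \<nu>s \<nu>" and l: "l < barycenter_fun X Y c m a \<mu> \<nu>"
  shows "\<forall>\<^sub>F n in sequentially. l < barycenter_fun X Y c m a \<mu> (\<nu>s n)"
proof -
  note \<nu>P = weak_limit_Pcost[OF \<nu>s bound \<nu> conv]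
  let ?G = "\<lambda>\<nu>. \<Sum>i<m. a i * (rKc (\<mu> i) \<nu> - rmoment \<nu>)"
  have split: "barycenter_fun X Y c m a \<mu> \<nu> = ?G \<nu> + rmoment \<nu>" for \<nu>
    by (simp add: barycenter_fun_def right_diff_distrib sum_subtractf sum_distrib_right[symmetric] a)
  \<comment> \<open>Half of the gap: \<open>?G\<close> and the moment may each lose up to
    \<open>e\<close>.\<close>
  define e where "e = (barycenter_fun X Y c m a \<mu> \<nu> - l) / 2"
  have e: "e > 0" using l by (simp add: e_def)
  have "(\<lambda>n. ?G (\<nu>s n)) \<longlonglongrightarrow> ?G \<nu>"
    using \<mu> by (intro tendsto_sum tendsto_mult tendsto_const Kc_minus_moment_weakly_continuous[OF _ \<nu>s bound \<nu> conv]) auto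
  then have 1: "\<forall>\<^sub>F n in sequentially. ?G \<nu> - e < ?G (\<nu>s n)"
    by (rule order_tendstoD) (use e in simp)
  \<comment> \<open>A negative level is treated apart because \<open>ennreal\<close> would truncate
    it to 0; moments are nonnegative, so it is exceeded trivially.\<close>
  have 2: "\<forall>\<^sub>F n in sequentially. rmoment \<nu> - e < rmoment (\<nu>s n)"
  proof (cases "rmoment \<nu> - e < 0")
    case True
    then show ?thesis by (intro always_eventually allI) (rule less_le_trans[OF _ enn2real_nonneg])
  next
    case False
    have "ennreal (rmoment \<nu> - e) < ennreal (rmoment \<nu>)"
      using e False by (subst ennreal_less_iff) auto
    then have "ennreal (rmoment \<nu> - e) < moment \<nu>" by (simp only: moment_real[OF \<nu>P(1)])
    from moment_lsc[OF Pcost_YD(1)[OF \<nu>s] \<nu> conv this] show ?thesis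
    proof (rule eventually_mono)
      fix n assume "ennreal (rmoment \<nu> - e) < moment (\<nu>s n)"
      then have "ennreal (rmoment \<nu> - e) < ennreal (rmoment (\<nu>s n))" by (simp only: moment_real[OF \<nu>s])
      then show "rmoment \<nu> - e < rmoment (\<nu>s n)"
        using False by (subst (asm) ennreal_less_iff) auto
    qed
  qed
  from 1 2 show ?thesis
  proof eventually_elim
    case (elim n)
    then have "?G \<nu> + rmoment \<nu> - 2 * e < ?G (\<nu>s n) + rmoment (\<nu>s n)" by linarith
    then have "barycenter_fun X Y c m a \<mu> \<nu> - 2 * e < barycenter_fun X Y c m a \<mu> (\<nu>s n)"
      unfolding split[symmetric] .
    moreover have "2 * e = barycenter_fun X Y c m a \<mu> \<nu> - l" by (simp add: e_def)
    ultimately show ?case by linarith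
  qed
qed

text \<open>Markov's inequality, with a sublevel set of \<open>c x0\<close>, compact by (A2), as
  K.\<close>

lemma moment_bounded_tight:
  assumes C: "C \<ge> 0" and \<epsilon>: "\<epsilon> > 0"
  obtains K where "compact K" "K \<subseteq> Y"
    "\<And>\<nu>. \<nu> \<in> Pcost_Y Y c x0 \<Longrightarrow> moment \<nu> \<le> ennreal C \<Longrightarrow> measure \<nu> (Y - K) \<le> \<epsilon>"
proof -
  \<comment> \<open>The added 1 keeps \<open>b\<close> positive when \<open>C\<close> is 0.\<close>
  define b where "b = (C + 1) / \<epsilon>"
  have b: "b > 0" "C / b \<le> \<epsilon>" using C \<epsilon> by (auto simp: b_def field_simps)
  let ?K = "{y\<in>Y. c x0 y \<le> b}"
  show thesis
  proof (rule that[of ?K])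
    show "compact ?K" by (rule compact_Y[OF basic(3)])
    fix \<nu> assume \<nu>: "\<nu> \<in> Pcost_Y Y c x0" and le: "moment \<nu> \<le> ennreal C"
    interpret \<nu>: prob_space \<nu> using ProbD(1)[OF Pcost_YD(1)[OF \<nu>]] .
    note sp = ProbD(2)[OF Pcost_YD(1)[OF \<nu>]]
    have "{y \<in> space \<nu>. \<not> c x0 y \<le> b} \<in> sets \<nu>"
      using Pcost_YD(3)[OF \<nu>] by measurable
    also have "{y \<in> space \<nu>. \<not> c x0 y \<le> b} = Y - ?K" using sp by auto
    finally have S: "Y - ?K \<in> sets \<nu>" .
    have "emeasure \<nu> (Y - ?K) = (\<integral>\<^sup>+y. indicator (Y - ?K) y \<partial>\<nu>)" using S by simp
    also have "\<dots> \<le> (\<integral>\<^sup>+y. ennreal (1 / b) * ennreal (c x0 y) \<partial>\<nu>)"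
    proof (rule nn_integral_mono)
      fix y assume "y \<in> space \<nu>"
      then have y: "y \<in> Y" using sp by simp
      have "1 \<le> 1 / b * c x0 y" if "\<not> c x0 y \<le> b" using b that by simp
      then show "indicator (Y - ?K) y \<le> ennreal (1 / b) * ennreal (c x0 y)"
        using b c_nonneg[OF basic(3) y]
        by (auto simp: indicator_def ennreal_mult[symmetric] simp flip: ennreal_1 intro!: ennreal_leI)
    qed
    also have "\<dots> = ennreal (1 / b) * moment \<nu>"
      using Pcost_YD(3)[OF \<nu>] by (intro nn_integral_cmult) simp
    also have "\<dots> \<le> ennreal (1 / b) * ennreal C" by (intro mult_left_mono le) simp
    also have "\<dots> = ennreal (C / b)" using b C by (simp add: ennreal_mult[symmetric])
    also have "\<dots> \<le> ennreal \<epsilon>" using b by (simp add: ennreal_leI)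
    finally show "measure \<nu> (Y - ?K) \<le> \<epsilon>"
      using \<epsilon> by (simp add: \<nu>.emeasure_eq_measure)
  qed auto
qed

text \<open>An admissible measure, so that the infimum of the functional is taken over a nonempty
  set.\<close>

lemma return_Pcost: "return (restrict_space borel Y) y0 \<in> Pcost_Y Y c x0"
proof -
  have "moment (return (restrict_space borel Y) y0) = ennreal (c x0 y0)"
    using borel_measurable_continuous_on_restrict[OF c_continuous_y[OF basic(3)]] basic(4)
    by (subst nn_integral_return) (auto simp: space_restrict_space)
  then show ?thesis using return_Prob[OF basic(4)] by (simp add: Pcost_Y_def)
qed

end

section \<open>Compactness of sublevel sets and the direct method\<close>

theorem mainTheorem1:
  fixes X Y :: "'a::euclidean_space set"
    and c :: "'a \<Rightarrow> 'a \<Rightarrow> real"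
    and x0 y0 :: 'a
    and m :: nat
    and a :: "nat \<Rightarrow> real"
    and \<mu> :: "nat \<Rightarrow> 'a measure"
  assumes std: "standing_assumptions X Y c x0 y0"
    and a_nz: "\<forall>i<m. a i \<noteq> 0"
    and a_sum: "(\<Sum>i<m. a i) = 1"
    and \<mu>_cost: "\<forall>i<m. \<mu> i \<in> Pcost_X X c y0"
  defines "\<B> \<equiv> barycenter_fun X Y c m a \<mu>"
    and "L \<equiv> (\<lambda>\<beta>::real. {\<nu> \<in> Pcost_Y Y c x0. barycenter_fun X Y c m a \<mu> \<nu> \<le> \<beta>})"
  shows
    \<comment> \<open>coercivity: uniformly bounded moments on sublevel sets\<close>
    "(\<forall>\<beta>. \<exists>C::real. \<forall>\<nu>\<in>L \<beta>. (\<integral>\<^sup>+ y. ennreal (c x0 y) \<partial>\<nu>) \<le> ennreal C)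
     \<comment> \<open>tightness of sublevel sets\<close>
     \<and> (\<forall>\<beta>. \<forall>\<epsilon>>0. \<exists>K. compact K \<and> K \<subseteq> Y \<and> (\<forall>\<nu>\<in>L \<beta>. measure \<nu> (Y - K) \<le> \<epsilon>))
     \<comment> \<open>weak sequential precompactness, with limit points in Pcost(Y)\<close>
     \<and> (\<forall>\<beta> (\<nu>s :: nat \<Rightarrow> 'a measure). (\<forall>n. \<nu>s n \<in> L \<beta>) \<longrightarrow>
          (\<exists>r \<nu>. strict_mono r \<and> \<nu> \<in> Pcost_Y Y c x0 \<and> weak_conv Y (\<nu>s \<circ> r) \<nu>))
     \<comment> \<open>weak limits of sequences in L beta lie in Pcost(Y), and B is weakly lsc along them\<close>
     \<and> (\<forall>\<beta> \<nu>s \<nu>. (\<forall>n. \<nu>s n \<in> L \<beta>) \<longrightarrow> \<nu> \<in> Prob Y \<longrightarrow> weak_conv Y \<nu>s \<nu> \<longrightarrow>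
          \<nu> \<in> Pcost_Y Y c x0 \<and> ereal (\<B> \<nu>) \<le> liminf (\<lambda>n. ereal (\<B> (\<nu>s n))))
     \<comment> \<open>existence of a signed barycenter\<close>
     \<and> (\<exists>\<nu>b\<in>Pcost_Y Y c x0. \<forall>\<nu>\<in>Pcost_Y Y c x0. \<B> \<nu>b \<le> \<B> \<nu>)"
proof -
  interpret transport_cost X Y c x0 y0
    by unfold_locales (rule std)
  obtain D where D: "\<And>\<nu>. \<nu> \<in> Pcost_Y Y c x0 \<Longrightarrow> rmoment \<nu> / 2 \<le> \<B> \<nu> + D"
    using barycenter_coercive[OF a_sum \<mu>_cost] unfolding \<B>_def by metis
  \<comment> \<open>Coercivity bounds the moment by 2 (\<beta> + D). The absolute value keeps the
    constant nonnegative, as \<open>moment_bounded_tight\<close> requires, even for a level whose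
    sublevel set is empty.\<close>
  define C where "C \<beta> = 2 * \<bar>\<beta> + D\<bar>" for \<beta>
  have L: "\<nu> \<in> Pcost_Y Y c x0" "\<B> \<nu> \<le> \<beta>" "moment \<nu> \<le> ennreal (C \<beta>)" if "\<nu> \<in> L \<beta>" for \<nu> \<beta>
  proof -
    show \<nu>: "\<nu> \<in> Pcost_Y Y c x0" and le: "\<B> \<nu> \<le> \<beta>"
      using that by (auto simp: L_def \<B>_def)
    have "rmoment \<nu> \<le> 2 * (\<beta> + D)" using D[OF \<nu>] le by simp
    also have "\<dots> \<le> C \<beta>" unfolding C_def by (intro mult_left_mono abs_ge_self) simp
    finally have "rmoment \<nu> \<le> C \<beta>" .
    then show "moment \<nu> \<le> ennreal (C \<beta>)"
      using ennreal_leI moment_real[OF \<nu>] by metis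
  qed
  have tight: "\<exists>K. compact K \<and> K \<subseteq> Y \<and> (\<forall>\<nu>\<in>L \<beta>. measure \<nu> (Y - K) \<le> \<epsilon>)" if "\<epsilon> > 0" for \<beta> \<epsilon> :: real
    using moment_bounded_tight[of "C \<beta>" \<epsilon>] that L unfolding C_def by (metis abs_ge_zero mult_nonneg_nonneg zero_le_numeral)
  have precompact: "\<exists>r \<nu>. strict_mono r \<and> \<nu> \<in> Pcost_Y Y c x0 \<and> weak_conv Y (\<nu>s \<circ> r) \<nu>"
    if \<nu>s: "\<forall>n. \<nu>s n \<in> L \<beta>" for \<beta> and \<nu>s :: "nat \<Rightarrow> 'a measure"
  proof -
    have "\<exists>r \<nu>. strict_mono r \<and> \<nu> \<in> Prob Y \<and> weak_conv Y (\<nu>s \<circ> r) \<nu>"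
    proof (rule weak_limit_of_tight[OF basic(2)])
      show "\<nu>s n \<in> Prob Y" for n using Pcost_YD(1) L(1) \<nu>s by blast
      show "\<exists>K. compact K \<and> K \<subseteq> Y \<and> (\<forall>n. measure (\<nu>s n) (Y - K) \<le> \<epsilon>)" if "\<epsilon> > 0" for \<epsilon> :: real
        using tight[OF that, of \<beta>] \<nu>s by blast
    qed
    then obtain r \<nu> where r: "strict_mono r" and \<nu>: "\<nu> \<in> Prob Y" and conv: "weak_conv Y (\<nu>s \<circ> r) \<nu>"
      by blast
    have "\<nu> \<in> Pcost_Y Y c x0"
      by (rule weak_limit_Pcost(1)[OF _ _ \<nu> conv, of "C \<beta>"]) (use \<nu>s L in auto)
    then show ?thesis using r conv by blast
  qed
  have lsc: "\<nu> \<in> Pcost_Y Y c x0" "l < \<B> \<nu> \<Longrightarrow> \<forall>\<^sub>F n in sequentially. l < \<B> (\<nu>s n)"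
    if \<nu>s: "\<forall>n. \<nu>s n \<in> L \<beta>" and \<nu>: "\<nu> \<in> Prob Y" and conv: "weak_conv Y \<nu>s \<nu>" for \<beta> \<nu>s \<nu> l
  proof -
    have *: "\<And>n. \<nu>s n \<in> Pcost_Y Y c x0" "\<And>n. moment (\<nu>s n) \<le> ennreal (C \<beta>)" using \<nu>s L by auto
    show "\<nu> \<in> Pcost_Y Y c x0" by (rule weak_limit_Pcost(1)[OF * \<nu> conv])
    show "l < \<B> \<nu> \<Longrightarrow> \<forall>\<^sub>F n in sequentially. l < \<B> (\<nu>s n)"
      unfolding \<B>_def by (rule barycenter_lsc[OF a_sum \<mu>_cost * \<nu> conv])
  qed
  have liminf: "ereal (\<B> \<nu>) \<le> liminf (\<lambda>n. ereal (\<B> (\<nu>s n)))"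
    if "\<forall>n. \<nu>s n \<in> L \<beta>" and "\<nu> \<in> Prob Y" and "weak_conv Y \<nu>s \<nu>" for \<beta> \<nu>s \<nu>
    unfolding le_Liminf_iff
  proof (intro allI impI)
    fix y assume y: "y < ereal (\<B> \<nu>)"
    then show "\<forall>\<^sub>F n in sequentially. y < ereal (\<B> (\<nu>s n))"
    \<comment> \<open>Only a real level has content: minus infinity lies below every value, and plus
      infinity below none.\<close>
    proof (cases y)
      case (real l)
      then show ?thesis using lsc(2)[OF that, of l] y by simp
    qed auto
  qed
  have minimizer: "\<exists>\<nu>b\<in>Pcost_Y Y c x0. \<forall>\<nu>\<in>Pcost_Y Y c x0. \<B> \<nu>b \<le> \<B> \<nu>"
  proof -
    define b where "b = Inf (\<B> ` Pcost_Y Y c x0)"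
    have ne: "\<B> ` Pcost_Y Y c x0 \<noteq> {}" using return_Pcost by blast
    have bdd: "bdd_below (\<B> ` Pcost_Y Y c x0)"
    proof (rule bdd_belowI2)
      fix \<nu> assume "\<nu> \<in> Pcost_Y Y c x0"
      from D[OF this] show "- D \<le> \<B> \<nu>" using enn2real_nonneg[of "moment \<nu>"] by linarith
    qed
    have "\<exists>\<nu>\<in>Pcost_Y Y c x0. \<B> \<nu> < b + 1 / real (Suc n)" for n
      using cInf_lessD[OF ne, of "b + 1 / real (Suc n)"] by (auto simp: b_def)
    then obtain \<nu>s where \<nu>s: "\<And>n. \<nu>s n \<in> Pcost_Y Y c x0" "\<And>n. \<B> (\<nu>s n) < b + 1 / real (Suc n)"
      by metis
    \<comment> \<open>The excess 1/(n+1) is at most 1, so the whole minimizing sequence stays in one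
      sublevel set.\<close>
    have \<nu>sL: "\<forall>n. \<nu>s n \<in> L (b + 1)"
    proof
      fix n
      have "1 / real (Suc n) \<le> 1" by simp
      then have "\<B> (\<nu>s n) \<le> b + 1" using \<nu>s(2)[of n] by linarith
      then show "\<nu>s n \<in> L (b + 1)" using \<nu>s(1)[of n] by (simp add: L_def \<B>_def)
    qed
    from precompact[OF this] obtain r \<nu>b where r: "strict_mono r" and \<nu>b: "\<nu>b \<in> Pcost_Y Y c x0"
      and conv: "weak_conv Y (\<nu>s \<circ> r) \<nu>b" by blast
    have "\<B> \<nu>b \<le> b"
    proof (rule ccontr)
      assume "\<not> \<B> \<nu>b \<le> b"
      \<comment> \<open>Along the subsequence the values eventually drop below this intermediate
        level, while semicontinuity keeps them eventually above it.\<close>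
      then obtain l where l: "b < l" "l < \<B> \<nu>b" using dense[of b "\<B> \<nu>b"] by (meson not_le)
      have "\<forall>\<^sub>F n in sequentially. l < \<B> ((\<nu>s \<circ> r) n)"
        using \<nu>sL by (intro lsc(2)[OF _ Pcost_YD(1)[OF \<nu>b] conv l(2), of "b + 1"]) simp
      moreover have "(\<lambda>n. b + 1 / real (Suc n)) \<longlonglongrightarrow> b"
        using LIMSEQ_inverse_real_of_nat_add[of b] by (simp add: inverse_eq_divide)
      then have "(\<lambda>n. b + 1 / real (Suc (r n))) \<longlonglongrightarrow> b"
        using LIMSEQ_subseq_LIMSEQ[OF _ r] by (simp add: comp_def)
      then have "\<forall>\<^sub>F n in sequentially. b + 1 / real (Suc (r n)) < l"
        using l(1) by (rule order_tendstoD)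
      ultimately have "\<forall>\<^sub>F n in sequentially. False"
      proof eventually_elim
        case (elim n)
        then show False using \<nu>s(2)[of "r n"] by simp
      qed
      then show False by simp
    qed
    moreover have "b \<le> \<B> \<nu>" if "\<nu> \<in> Pcost_Y Y c x0" for \<nu>
      unfolding b_def using that by (intro cINF_lower[OF bdd])
    ultimately show ?thesis using \<nu>b by (intro bexI[of _ \<nu>b]) (auto intro: order_trans)
  qed
  show ?thesis
  proof (intro conjI)
    show "\<forall>\<beta>. \<exists>C::real. \<forall>\<nu>\<in>L \<beta>. moment \<nu> \<le> ennreal C"
      using L(3) by blast
    show "\<forall>\<beta> \<nu>s \<nu>. (\<forall>n. \<nu>s n \<in> L \<beta>) \<longrightarrow> \<nu> \<in> Prob Y \<longrightarrow> weak_conv Y \<nu>s \<nu> \<longrightarrow>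
          \<nu> \<in> Pcost_Y Y c x0 \<and> ereal (\<B> \<nu>) \<le> liminf (\<lambda>n. ereal (\<B> (\<nu>s n)))"
      using lsc(1) liminf by meson
  qed (use tight precompact minimizer in blast)+
qed

end
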